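(* Consider one of the following seven settings: the Fourier space (for which $\square=a$), or the cosine space or the Chebyshev space with plan A, B or C ($\square=a,b,c$ respectively). Let $f\in\mathcal{F}$ be a function in the chosen space, let $\Lambda$ be a finite nonempty index set ($\Lambda\subset\mathbb{Z}^d$ for the Fourier space, $\Lambda\subset\mathbb{N}_0^d$ for the cosine and Chebyshev spaces), and let $f_\Lambda^\square$ be the approximation of $f$ obtained from an $n$-point rank-1 lattice with generating vector $\boldsymbol{z}$ admissible for the chosen setting (all as defined in the context). Then $$\|f-f_\Lambda^\square\|_{L^2_\mu}^2\le\|f-f_\Lambda\|_{L^2_\mu}^2+\rho_\Lambda^\square\,\|f-f_\Lambda\|_n^2 .$$ We have $\rho_\Lambda^a=1$, and if $\Lambda\subset\mathbb{N}_0^d$ is downward closed then $\rho_\Lambda^c\le\rho_\Lambda^b\le\min(2^{d-1},\#\Lambda)$. Moreover, $$\|f-f_\Lambda^\square\|_{L^2_\mu}\le\sqrt{1+\rho_\Lambda^\square}\;\|f-f_\Lambda\|_{L^\infty}.$$ Regarding the requirement on $n$: an admissible $\boldsymbol{z}$ exists for every prime $n$ satisfying $n>\max\{N,\,2\max(\Lambda)\}$, where $N=\tfrac12(\#(\Lambda\ominus\Lambda)+1)$ for the Fourier space, and for the cosine and Chebyshev spaces $N=\tfrac12(\#(\mathcal{M}(\Lambda)\oplus\mathcal{M}(\Lambda))+1)$ with plan A, $N=\#(\Lambda\oplus\mathcal{M}(\Lambda))$ with plan B, and $N=\#\Lambda\cdot\#\mathcal{M}(\Lambda)$ with plan C.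
   Context: Index notation: $|\boldsymbol{k}|_0$ is the number of nonzero components of $\boldsymbol{k}$; $\boldsymbol{\sigma}(\boldsymbol{k})=(\sigma_1k_1,\ldots,\sigma_dk_d)$ for $\boldsymbol{\sigma}\in\{\pm1\}^d$; $\mathcal{S}_{\boldsymbol{k}}=\{\boldsymbol{\sigma}\in\{\pm1\}^d:\sigma_j=+1\text{ if }k_j=0\}$; $\mathcal{M}(\Lambda)=\{\boldsymbol{\sigma}(\boldsymbol{k}):\boldsymbol{k}\in\Lambda,\boldsymbol{\sigma}\in\{\pm1\}^d\}$; $A\oplus B=\{\boldsymbol{a}+\boldsymbol{b}:\boldsymbol{a}\in A,\boldsymbol{b}\in B\}$, $A\ominus B=\{\boldsymbol{a}-\boldsymbol{b}:\boldsymbol{a}\in A,\boldsymbol{b}\in B\}$; $\max(\Lambda)=\max_{\boldsymbol{k}\in\Lambda}\max_j|k_j|$. $\Lambda\subset\mathbb{N}_0^d$ is downward closed if $\boldsymbol{k}'\in\Lambda$ whenever $\boldsymbol{k}\in\Lambda$, $\boldsymbol{k}'\in\mathbb{N}_0^d$ and $\boldsymbol{k}'\le\boldsymbol{k}$ componentwise. Spaces. Each space $\mathcal{F}$ consists of functions $f=\sum_{\boldsymbol{k}}\widehat f_{\boldsymbol{k}}\,\alpha_{\boldsymbol{k}}$ with $\sum_{\boldsymbol{k}}|\widehat f_{\boldsymbol{k}}|<\infty$, where $\{\alpha_{\boldsymbol{k}}\}$ is an orthonormal basis of $L^2_\mu(\Omega)$, $\mu(\Omega)=1$, and $\widehat f_{\boldsymbol{k}}=\int_\Omega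 f\,\overline{\alpha_{\boldsymbol{k}}}\,d\mu$: - Fourier: complex-valued functions on $\Omega=[0,1]^d$, $\mu$ Lebesgue, $\boldsymbol{k}\in\mathbb{Z}^d$, $\alpha_{\boldsymbol{k}}(\boldsymbol{x})=e^{2\pi \mathrm{i}\boldsymbol{k}\cdot\boldsymbol{x}}$. - Cosine: real-valued functions on $\Omega=[0,1]^d$, $\mu$ Lebesgue, $\boldsymbol{k}\in\mathbb{N}_0^d$, $\alpha_{\boldsymbol{k}}(\boldsymbol{x})=\sqrt2^{\,|\boldsymbol{k}|_0}\prod_{j=1}^d\cos(\pi k_jx_j)$. - Chebyshev: real-valued functions on $\Omega=[-1,1]^d$, $\mu(d\boldsymbol{x})=d\boldsymbol{x}/\prod_{j=1}^d(\pi\sqrt{1-x_j^2})$, $\boldsymbol{k}\in\mathbb{N}_0^d$, $\alpha_{\boldsymbol{k}}(\boldsymbol{x})=\sqrt2^{\,|\boldsymbol{k}|_0}\prod_{j=1}^d\cos(k_j\arccos x_j)$. Let $f_\Lambda:=\sum_{\boldsymbol{k}\in\Lambda}\widehat f_{\boldsymbol{k}}\alpha_{\boldsymbol{k}}$. Transformations. With the tent transform $\varphi_{\rm tent}(x)=1-|2x-1|$ applied componentwise, let $\varphi:[0,1]^d\to\Omega$ be the identity (Fourier), $\varphi_{\rm tent}$ (cosine), or $\cos(\pi\varphi_{\rm tent}(\cdot))=\cos(2\pi\,\cdot)$ componentwise (Chebyshev). Let $u_{\boldsymbol{k}}=\alpha_{\boldsymbol{k}}\circ\varphi$, i.e. $u_{\boldsymbol{k}}(\boldsymbol{x})=e^{2\pi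 \mathrm{i}\boldsymbol{k}\cdot\boldsymbol{x}}$ (Fourier) or $\sqrt2^{\,|\boldsymbol{k}|_0}\prod_j\cos(2\pi k_jx_j)$ (cosine/Chebyshev). Let $v_{\boldsymbol{k}}=u_{\boldsymbol{k}}$ for Fourier and for plan A, and $v_{\boldsymbol{k}}(\boldsymbol{x})=\sqrt2^{\,|\boldsymbol{k}|_0}\cos(2\pi\boldsymbol{k}\cdot\boldsymbol{x})$ for plans B and C. Lattice. For $\boldsymbol{z}\in\mathbb{Z}^d$ let $\boldsymbol{t}_i=(i\boldsymbol{z}\bmod n)/n$ (componentwise), $i=0,\ldots,n-1$, and $Q_n(g)=\frac1n\sum_{i=0}^{n-1}g(\boldsymbol{t}_i)$. Let $c_{\boldsymbol{k}}=\#\{\boldsymbol{\sigma}\in\mathcal{S}_{\boldsymbol{k}}:\boldsymbol{\sigma}(\boldsymbol{k})\cdot\boldsymbol{z}\equiv\boldsymbol{k}\cdot\boldsymbol{z}\ (\mathrm{mod}\ n)\}$ for plan C and $c_{\boldsymbol{k}}=1$ otherwise. Let $d_{\boldsymbol{k}}=2^{|\boldsymbol{k}|_0-1}$ for $\boldsymbol{k}\neq\boldsymbol{0}$ in plans B and C, and $d_{\boldsymbol{k}}=1$ otherwise. The vector $\boldsymbol{z}$ is called admissible for the chosen setting if $$Q_n(u_{\boldsymbol{k}}\overline{v_{\boldsymbol{k}'}})=c_{\boldsymbol{k}}\,\delta_{\boldsymbol{k},\boldsymbol{k}'}\quad\text{and}\quad Q_n(v_{\boldsymbol{k}}\overline{v_{\boldsymbol{k}'}})=d_{\boldsymbol{k}}\,\delta_{\boldsymbol{k},\boldsymbol{k}'}\quad\text{for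 all }\boldsymbol{k},\boldsymbol{k}'\in\Lambda.$$ The approximation is $f_\Lambda^\square:=\sum_{\boldsymbol{k}\in\Lambda}\widehat f^{\,\square}_{\boldsymbol{k}}\alpha_{\boldsymbol{k}}$ with $\widehat f^{\,\square}_{\boldsymbol{k}}:=Q_n((f\circ\varphi)\,\overline{v_{\boldsymbol{k}}})\,c_{\boldsymbol{k}}^{-1}$. Stability constants and seminorm: $\rho_\Lambda^\square:=\max_{\boldsymbol{k}\in\Lambda}d_{\boldsymbol{k}}/c_{\boldsymbol{k}}^2$, that is, $\rho_\Lambda^a=1$, $\rho_\Lambda^b=\max\big(1_{\boldsymbol{0}\in\Lambda},\max_{\boldsymbol{k}\in\Lambda\setminus\{\boldsymbol{0}\}}2^{|\boldsymbol{k}|_0-1}\big)$, $\rho_\Lambda^c=\max\big(1_{\boldsymbol{0}\in\Lambda},\max_{\boldsymbol{k}\in\Lambda\setminus\{\boldsymbol{0}\}}2^{|\boldsymbol{k}|_0-1}/c_{\boldsymbol{k}}^2\big)$, where $1_{\boldsymbol{0}\in\Lambda}$ is $1$ if $\boldsymbol{0}\in\Lambda$ and $0$ otherwise. $\|h\|_n^2:=\frac1n\sum_{i=0}^{n-1}|h(\varphi(\boldsymbol{t}_i))|^2$. *)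

theory Defs
  imports "HOL-Analysis.Analysis" "HOL-Probability.Essential_Supremum"
    "HOL-Computational_Algebra.Primes"
begin

datatype plan = PlanA | PlanB | PlanC

text \<open>The Fourier space has no choice of plan; its constants are those of plan A.\<close>

datatype setting = Fourier | Cosine plan | Chebyshev plan

fun plan_of :: "setting \<Rightarrow> plan" where
  "plan_of Fourier = PlanA"
| "plan_of (Cosine p) = p"
| "plan_of (Chebyshev p) = p"


subsection \<open>Multi-indices\<close>

text \<open>All multi-indices live in the type of integer vectors; the dimension is the cardinality
  of the index type, and nonnegative multi-indices are singled out as a subset.\<close>

definition nonneg_indices :: "(int^'d) set" where
  "nonneg_indices = {k. \<forall>j. 0 \<le> k $ j}"

fun index_domain :: "setting \<Rightarrow> (int^'d) set" where
  "index_domain Fourier = UNIV"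
| "index_domain (Cosine p) = nonneg_indices"
| "index_domain (Chebyshev p) = nonneg_indices"

definition nnz :: "int^'d \<Rightarrow> nat" where
  "nnz k = card {j. k $ j \<noteq> 0}"

definition idot :: "int^'d \<Rightarrow> int^'d \<Rightarrow> int" where
  "idot k z = (\<Sum>j\<in>UNIV. k $ j * z $ j)"

definition rdot :: "int^'d \<Rightarrow> real^'d \<Rightarrow> real" where
  "rdot k x = (\<Sum>j\<in>UNIV. real_of_int (k $ j) * x $ j)"

definition signs :: "(int^'d) set" where
  "signs = {\<sigma>. \<forall>j. \<sigma> $ j = 1 \<or> \<sigma> $ j = -1}"

definition signs_for :: "int^'d \<Rightarrow> (int^'d) set" where
  "signs_for k = {\<sigma> \<in> signs. \<forall>j. k $ j = 0 \<longrightarrow> \<sigma> $ j = 1}"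

definition flip :: "int^'d \<Rightarrow> int^'d \<Rightarrow> int^'d" where
  "flip \<sigma> k = (\<chi> j. \<sigma> $ j * k $ j)"

definition mirror :: "(int^'d) set \<Rightarrow> (int^'d) set" where
  "mirror \<Lambda> = {flip \<sigma> k | \<sigma> k. k \<in> \<Lambda> \<and> \<sigma> \<in> signs}"

definition set_sum :: "(int^'d) set \<Rightarrow> (int^'d) set \<Rightarrow> (int^'d) set" where
  "set_sum A B = {a + b | a b. a \<in> A \<and> b \<in> B}"

definition set_diff :: "(int^'d) set \<Rightarrow> (int^'d) set \<Rightarrow> (int^'d) set" where
  "set_diff A B = {a - b | a b. a \<in> A \<and> b \<in> B}"

definition max_abs :: "(int^'d) set \<Rightarrow> int" where
  "max_abs \<Lambda> = Max {\<bar>k $ j\<bar> | k j. k \<in> \<Lambda>}"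

definition downward_closed :: "(int^'d) set \<Rightarrow> bool" where
  "downward_closed \<Lambda> \<longleftrightarrow> \<Lambda> \<subseteq> nonneg_indices \<and>
    (\<forall>k\<in>\<Lambda>. \<forall>k'\<in>nonneg_indices. (\<forall>j. k' $ j \<le> k $ j) \<longrightarrow> k' \<in> \<Lambda>)"


subsection \<open>Function spaces\<close>

fun domain_of :: "setting \<Rightarrow> (real^'d) set" where
  "domain_of Fourier = cbox (vec 0) (vec 1)"
| "domain_of (Cosine p) = cbox (vec 0) (vec 1)"
| "domain_of (Chebyshev p) = cbox (vec (-1)) (vec 1)"

text \<open>The Chebyshev weight is singular where some coordinate is \<open>1\<close> or \<open>-1\<close>; division by zero
  makes the density zero there, on a Lebesgue null set.\<close>

fun mu :: "setting \<Rightarrow> (real^'d) measure" where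
  "mu Fourier = restrict_space lborel (domain_of Fourier)"
| "mu (Cosine p) = restrict_space lborel (domain_of (Cosine p))"
| "mu (Chebyshev p) = density (restrict_space lborel (domain_of (Chebyshev p)))
     (\<lambda>x. ennreal (1 / (\<Prod>j\<in>UNIV. pi * sqrt (1 - (x $ j)\<^sup>2))))"

fun alpha :: "setting \<Rightarrow> int^'d \<Rightarrow> real^'d \<Rightarrow> complex" where
  "alpha Fourier k x = exp (2 * of_real pi * \<i> * of_real (rdot k x))"
| "alpha (Cosine p) k x =
     of_real (sqrt 2 ^ nnz k * (\<Prod>j\<in>UNIV. cos (pi * real_of_int (k $ j) * x $ j)))"
| "alpha (Chebyshev p) k x =
     of_real (sqrt 2 ^ nnz k * (\<Prod>j\<in>UNIV. cos (real_of_int (k $ j) * arccos (x $ j))))"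

definition coef :: "setting \<Rightarrow> (real^'d \<Rightarrow> complex) \<Rightarrow> int^'d \<Rightarrow> complex" where
  "coef s f k = (LINT x|mu s. f x * cnj (alpha s k x))"

text \<open>Functions on the domain are represented by total complex-valued functions whose values
  outside the domain are irrelevant. The series represents the function at every point of the
  domain, so that sampling is meaningful and membership forces continuity on the domain.\<close>

definition function_space :: "setting \<Rightarrow> (real^'d \<Rightarrow> complex) set" where
  "function_space s = {f.
     (\<lambda>k. norm (coef s f k)) summable_on index_domain s \<and>
     (\<forall>x\<in>domain_of s. ((\<lambda>k. coef s f k * alpha s k x) has_sum f x) (index_domain s)) \<and>
     (s \<noteq> Fourier \<longrightarrow> (\<forall>x\<in>domain_of s. f x \<in> \<real>))}"

definition truncation :: "setting \<Rightarrow> (int^'d) set \<Rightarrow> (real^'d \<Rightarrow> complex) \<Rightarrow> real^'d \<Rightarrow> complex" where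
  "truncation s \<Lambda> f x = (\<Sum>k\<in>\<Lambda>. coef s f k * alpha s k x)"

definition L2_norm :: "'a measure \<Rightarrow> ('a \<Rightarrow> complex) \<Rightarrow> real" where
  "L2_norm M h = sqrt (LINT x|M. (norm (h x))\<^sup>2)"

definition Linf_norm :: "'a measure \<Rightarrow> ('a \<Rightarrow> complex) \<Rightarrow> ereal" where
  "Linf_norm M h = esssup M (\<lambda>x. ereal (norm (h x)))"


subsection \<open>Lattice approximation\<close>

definition tent :: "real \<Rightarrow> real" where
  "tent x = 1 - \<bar>2 * x - 1\<bar>"

fun phi :: "setting \<Rightarrow> real^'d \<Rightarrow> real^'d" where
  "phi Fourier x = x"
| "phi (Cosine p) x = (\<chi> j. tent (x $ j))"
| "phi (Chebyshev p) x = (\<chi> j. cos (pi * tent (x $ j)))"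

definition u_fun :: "setting \<Rightarrow> int^'d \<Rightarrow> real^'d \<Rightarrow> complex" where
  "u_fun s k x = alpha s k (phi s x)"

definition v_fun :: "setting \<Rightarrow> int^'d \<Rightarrow> real^'d \<Rightarrow> complex" where
  "v_fun s k x = (if plan_of s = PlanA then u_fun s k x
     else of_real (sqrt 2 ^ nnz k * cos (2 * pi * rdot k x)))"

definition lattice_point :: "nat \<Rightarrow> int^'d \<Rightarrow> nat \<Rightarrow> real^'d" where
  "lattice_point n z i = (\<chi> j. real_of_int ((int i * z $ j) mod int n) / real n)"

definition lattice_rule :: "nat \<Rightarrow> int^'d \<Rightarrow> (real^'d \<Rightarrow> complex) \<Rightarrow> complex" where
  "lattice_rule n z g = (\<Sum>i<n. g (lattice_point n z i)) / of_nat n"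

definition c_const :: "plan \<Rightarrow> nat \<Rightarrow> int^'d \<Rightarrow> int^'d \<Rightarrow> nat" where
  "c_const p n z k = (if p = PlanC
     then card {\<sigma> \<in> signs_for k. idot (flip \<sigma> k) z mod int n = idot k z mod int n} else 1)"

definition d_const :: "plan \<Rightarrow> int^'d \<Rightarrow> nat" where
  "d_const p k = (if k \<noteq> 0 \<and> p \<noteq> PlanA then 2 ^ (nnz k - 1) else 1)"

definition admissible :: "setting \<Rightarrow> nat \<Rightarrow> (int^'d) set \<Rightarrow> int^'d \<Rightarrow> bool" where
  "admissible s n \<Lambda> z \<longleftrightarrow> (\<forall>k\<in>\<Lambda>. \<forall>k'\<in>\<Lambda>.
     lattice_rule n z (\<lambda>x. u_fun s k x * cnj (v_fun s k' x)) =
       (if k = k' then of_nat (c_const (plan_of s) n z k) else 0) \<and>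
     lattice_rule n z (\<lambda>x. v_fun s k x * cnj (v_fun s k' x)) =
       (if k = k' then of_nat (d_const (plan_of s) k) else 0))"

definition lattice_coef ::
  "setting \<Rightarrow> nat \<Rightarrow> int^'d \<Rightarrow> (real^'d \<Rightarrow> complex) \<Rightarrow> int^'d \<Rightarrow> complex" where
  "lattice_coef s n z f k =
     lattice_rule n z (\<lambda>x. f (phi s x) * cnj (v_fun s k x)) / of_nat (c_const (plan_of s) n z k)"

definition lattice_approx ::
  "setting \<Rightarrow> nat \<Rightarrow> int^'d \<Rightarrow> (int^'d) set \<Rightarrow> (real^'d \<Rightarrow> complex) \<Rightarrow> real^'d \<Rightarrow> complex" where
  "lattice_approx s n z \<Lambda> f x = (\<Sum>k\<in>\<Lambda>. lattice_coef s n z f k * alpha s k x)"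

definition rho :: "plan \<Rightarrow> nat \<Rightarrow> int^'d \<Rightarrow> (int^'d) set \<Rightarrow> real" where
  "rho p n z \<Lambda> = Max ((\<lambda>k. real (d_const p k) / (real (c_const p n z k))\<^sup>2) ` \<Lambda>)"

definition sampling_seminorm :: "setting \<Rightarrow> nat \<Rightarrow> int^'d \<Rightarrow> (real^'d \<Rightarrow> complex) \<Rightarrow> real" where
  "sampling_seminorm s n z h =
     sqrt ((\<Sum>i<n. (norm (h (phi s (lattice_point n z i))))\<^sup>2) / real n)"

definition plan_threshold :: "plan \<Rightarrow> (int^'d) set \<Rightarrow> real" where
  "plan_threshold p \<Lambda> = (case p of
     PlanA \<Rightarrow> (real (card (set_sum (mirror \<Lambda>) (mirror \<Lambda>))) + 1) / 2
   | PlanB \<Rightarrow> real (card (set_sum \<Lambda> (mirror \<Lambda>)))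
   | PlanC \<Rightarrow> real (card \<Lambda> * card (mirror \<Lambda>)))"

fun threshold :: "setting \<Rightarrow> (int^'d) set \<Rightarrow> real" where
  "threshold Fourier \<Lambda> = (real (card (set_diff \<Lambda> \<Lambda>)) + 1) / 2"
| "threshold (Cosine p) \<Lambda> = plan_threshold p \<Lambda>"
| "threshold (Chebyshev p) \<Lambda> = plan_threshold p \<Lambda>"

end

theory Submission
  imports Defs
begin

text \<open>
  Two orthogonality relations drive the error bounds. Write \<open>g = f - f\<^sub>\<Lambda>\<close> for the remainder of
  the truncated series. The basis functions are orthonormal for \<open>\<mu>\<close>, so \<open>g\<close> is orthogonal to
  all \<open>\<alpha>\<^sub>k\<close> with \<open>k\<close> in \<open>\<Lambda>\<close>, and by Pythagoras the squared error of the lattice approximation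
  is the squared norm of \<open>g\<close> plus the sum of the squared coefficient errors
  (\<open>integral_norm_square_diff_sum\<close>). The first admissibility condition says that the sampled
  coefficients of \<open>f\<^sub>\<Lambda>\<close> are exact, whence the coefficient error at \<open>k\<close> is the aliasing term
  \<open>Q\<^sub>n(g v\<^sub>k) / c\<^sub>k\<close> (\<open>lattice_coef_minus_coef\<close>). The second condition says that the \<open>v\<^sub>k\<close> are
  orthogonal under the lattice rule with squared norms \<open>d\<^sub>k\<close>, so Bessel's inequality bounds the
  sum of \<open>|Q\<^sub>n(g v\<^sub>k)|\<^sup>2 / d\<^sub>k\<close> by the squared sampling seminorm of \<open>g\<close>; the largest ratio
  \<open>d\<^sub>k / c\<^sub>k\<^sup>2\<close> is the factor that remains. The supremum bound follows because both norms of \<open>g\<close> are at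
  most its essential supremum: \<open>g\<close> is continuous on the domain and \<open>\<mu>\<close> charges every nonempty
  relatively open subset, so the essential supremum dominates \<open>g\<close> at each sampling point as well
  (\<open>continuous_le_of_AE\<close>).

  For the existence of \<open>z\<close>, each transplanted function \<open>u\<^sub>k\<close> or \<open>v\<^sub>k\<close> is a multiple of a sum of
  complex exponentials: over all sign changes of \<open>k\<close> for a product of cosines, and over
  \<open>k\<close> and \<open>-k\<close> for a single cosine. The lattice rule maps the exponential of frequency \<open>h\<close> to
  \<open>1\<close> if \<open>n\<close> divides \<open>h \<cdot> z\<close> and to \<open>0\<close> otherwise. Hence \<open>z\<close> is admissible as soon as
  \<open>h \<cdot> z\<close> is nonzero modulo \<open>n\<close> for all nonzero \<open>h\<close> in a difference set depending on the plan,
  and the scalar products reduce to counting common frequencies. A nonzero \<open>h\<close> with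
  components smaller in absolute value than the prime \<open>n\<close> annihilates at most the fraction \<open>1/n\<close> of all \<open>z\<close>
  modulo \<open>n\<close>, so a union bound leaves a good vector (\<open>ex_non_annihilator\<close>). For the Fourier space and plan A the difference set is symmetric, and
  \<open>h\<close> and \<open>-h\<close> annihilate the same vectors, which halves the bound. For plan C the vector for
  plan B is good enough: it has \<open>c\<^sub>k = 1\<close>, and \<open>\<Lambda> \<oplus> \<M>(\<Lambda>)\<close> has at most
  \<open>#\<Lambda> \<cdot> #\<M>(\<Lambda>)\<close> elements.
\<close>


section \<open>Vectors separating a finite set of frequencies modulo a prime\<close>

lemma finite_vectors_over:
  assumes "finite A"
  shows "finite {z :: 'a^'d. \<forall>j. z $ j \<in> A}"
proof (rule finite_subset)
  show "{z :: 'a^'d. \<forall>j. z $ j \<in> A} \<subseteq> vec_lambda ` (UNIV \<rightarrow>\<^sub>E A)"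
  proof
    fix z :: "'a^'d" assume "z \<in> {z. \<forall>j. z $ j \<in> A}"
    then have "vec_nth z \<in> UNIV \<rightarrow>\<^sub>E A" by auto
    then show "z \<in> vec_lambda ` (UNIV \<rightarrow>\<^sub>E A)"
      by (metis image_eqI vec_nth_inverse)
  qed
qed (use assms in \<open>intro finite_imageI finite_PiE; simp\<close>)

text \<open>Translating a zero of the linear form \<open>h\<close> along a coordinate \<open>j\<close> where \<open>h\<close> is invertible
  modulo \<open>n\<close> reaches each residue vector at most once: the value of \<open>h\<close> at the translate
  determines the translation, which in turn determines the zero.\<close>

lemma annihilator_density:
  fixes h :: "int^'d" and n :: nat
  defines "Z \<equiv> {z::int^'d. \<forall>j. z $ j \<in> {0..<int n}}"
  assumes "prime n" and j: "\<not> int n dvd h $ j"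
  shows "card {z \<in> Z. int n dvd idot h z} * n \<le> card Z"
proof -
  have fin: "finite Z" unfolding Z_def by (rule finite_vectors_over) simp
  let ?B = "{z \<in> Z. int n dvd idot h z}"
  define shift where "shift = (\<lambda>(z::int^'d, t). \<chi> i. if i = j then (z $ j + t) mod int n else z $ i)"
  have n0: "int n > 0" using \<open>prime n\<close> prime_gt_0_nat by auto
  have idot_shift: "int n dvd (idot h (shift (z, t)) - (idot h z + h $ j * t))" for z t
  proof -
    have "idot h (shift (z,t)) - (idot h z + h $ j * t)
        = (\<Sum>i\<in>UNIV. h $ i * (shift (z,t) $ i - z $ i - (if i = j then t else 0)))"
    proof -
      have "(\<Sum>i\<in>UNIV. h $ i * (if i = j then t else 0)) = h $ j * t"
        by (simp add: if_distrib sum.delta cong: if_cong)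
      then show ?thesis
        by (simp add: idot_def right_diff_distrib sum_subtractf)
    qed
    also have "int n dvd \<dots>"
    proof (rule dvd_sum)
      fix i
      have "int n dvd (z $ j + t) mod int n - (z $ j + t)"
        by (simp add: mod_eq_dvd_iff flip: mod_eq_dvd_iff)
      then show "int n dvd h $ i * (shift (z,t) $ i - z $ i - (if i = j then t else 0))"
        by (auto simp: shift_def diff_diff_add)
    qed
    finally show ?thesis .
  qed
  have inj: "inj_on shift (?B \<times> {0..<int n})"
  proof (rule inj_onI, clarify)
    fix z z' t t'
    assume z: "z \<in> Z" "int n dvd idot h z" "t \<in> {0..<int n}"
       and z': "z' \<in> Z" "int n dvd idot h z'" "t' \<in> {0..<int n}"
       and eq: "shift (z, t) = shift (z', t')"
    have "int n dvd idot h (shift (z, t)) - h $ j * t"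
      using dvd_add[OF idot_shift[of z t] z(2)] by simp
    moreover have "int n dvd idot h (shift (z, t)) - h $ j * t'"
      using dvd_add[OF idot_shift[of z' t'] z'(2)] eq by simp
    ultimately have "int n dvd (idot h (shift (z, t)) - h $ j * t) - (idot h (shift (z, t)) - h $ j * t')"
      by (rule dvd_diff)
    then have "int n dvd h $ j * (t' - t)" by (simp add: right_diff_distrib)
    then have "int n dvd t' - t"
      using j \<open>prime n\<close> prime_dvd_mult_iff[of "int n"] by auto
    then have tt: "t' = t"
      using z(3) z'(3) by (metis atLeastLessThan_iff mod_eq_dvd_iff mod_pos_pos_trivial)
    have "z $ i = z' $ i" for i
    proof (cases "i = j")
      case False
      then show ?thesis using arg_cong[OF eq, of "\<lambda>w. w $ i"] by (simp add: shift_def)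
    next
      case True
      have "(z $ j + t) mod int n = (z' $ j + t) mod int n"
        using arg_cong[OF eq, of "\<lambda>w. w $ j"] tt by (simp add: shift_def)
      then have "int n dvd z $ j - z' $ j" by (simp add: mod_eq_dvd_iff)
      moreover have "z $ j \<in> {0..<int n}" "z' $ j \<in> {0..<int n}" using z z' by (auto simp: Z_def)
      ultimately show ?thesis using True
        by (metis atLeastLessThan_iff mod_eq_dvd_iff mod_pos_pos_trivial)
    qed
    then show "z = z' \<and> t = t'" using tt by (simp add: vec_eq_iff)
  qed
  have "shift ` (?B \<times> {0..<int n}) \<subseteq> Z"
    using n0 by (auto simp: Z_def shift_def)
  from card_mono[OF fin this] show ?thesis
    by (simp add: card_image[OF inj] card_cartesian_product)
qed

text \<open>If every vector annihilated \<open>m\<close> or more elements of \<open>H\<close>, counting the annihilating pairs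
  with the previous bound would give \<open>m * n \<le> card H\<close>. The multiplicity \<open>m\<close> is
  \<open>2\<close> for families of nonzero vectors closed under negation, which halves the required size of the modulus.\<close>

lemma ex_non_annihilator:
  fixes H :: "(int^'d) set"
  assumes "prime n" "finite H" "card H < m * n"
    and H: "\<And>h. h \<in> H \<Longrightarrow> \<exists>j. \<not> int n dvd h $ j"
    and m: "\<And>h z. h \<in> H \<Longrightarrow> int n dvd idot h z \<Longrightarrow> m \<le> card {h \<in> H. int n dvd idot h z}"
  obtains z where "\<And>h. h \<in> H \<Longrightarrow> \<not> int n dvd idot h z"
proof (rule ccontr)
  assume "\<not> thesis"
  then have "\<exists>h\<in>H. int n dvd idot h z" for z using that by blast
  then have m': "m \<le> card {h \<in> H. int n dvd idot h z}" for z using m by blast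
  define Z where "Z = {z::int^'d. \<forall>j. z $ j \<in> {0..<int n}}"
  have fin: "finite Z" unfolding Z_def by (rule finite_vectors_over) simp
  have "0 \<in> Z" using \<open>prime n\<close> prime_gt_0_nat by (auto simp: Z_def)
  then have Z0: "card Z > 0" using fin card_gt_0_iff by blast
  have "m * card Z = (\<Sum>z\<in>Z. m)" by simp
  also have "\<dots> \<le> (\<Sum>z\<in>Z. card {h \<in> H. int n dvd idot h z})"
    by (intro sum_mono m')
  also have "\<dots> = (\<Sum>h\<in>H. card {z \<in> Z. int n dvd idot h z})"
    by (rule sum_multicount_gen[OF fin \<open>finite H\<close>]) auto
  finally have "m * n * card Z \<le> (\<Sum>h\<in>H. card {z \<in> Z. int n dvd idot h z} * n)"
    by (simp add: mult.commute mult.left_commute flip: sum_distrib_left sum_distrib_right)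
  also have "\<dots> \<le> (\<Sum>h\<in>H. card Z)"
  proof (rule sum_mono)
    fix h assume "h \<in> H"
    then obtain j where "\<not> int n dvd h $ j" using H by blast
    from annihilator_density[OF \<open>prime n\<close> this]
    show "card {z \<in> Z. int n dvd idot h z} * n \<le> card Z" by (simp add: Z_def)
  qed
  also have "\<dots> = card H * card Z" by simp
  finally show False using Z0 \<open>card H < m * n\<close> by simp
qed

lemma not_dvd_of_small_component:
  fixes h :: "int^'d"
  assumes "h \<noteq> 0" "\<And>j. \<bar>h $ j\<bar> < int n"
  shows "\<exists>j. \<not> int n dvd h $ j"
proof -
  obtain j where "h $ j \<noteq> 0" using assms(1) by (auto simp: vec_eq_iff)
  then show ?thesis using assms(2)[of j] zdvd_imp_le[of "int n" "\<bar>h $ j\<bar>"] by force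
qed

lemma idot_uminus: "idot (- h) z = - idot h z"
  by (simp add: idot_def sum_negf)

lemma vec_uminus_eq_self_iff: "- k = k \<longleftrightarrow> k = 0" for k :: "int^'d"
  by (auto simp: vec_eq_iff)

lemma ex_separating_vector:
  fixes D :: "(int^'d) set"
  assumes "prime n" "finite D" "0 \<in> D" "card D \<le> n"
    and D: "\<And>h j. h \<in> D \<Longrightarrow> \<bar>h $ j\<bar> < int n"
  obtains z where "\<And>h. h \<in> D \<Longrightarrow> int n dvd idot h z \<longleftrightarrow> h = 0"
proof -
  let ?H = "D - {0}"
  have "card ?H < 1 * n"
    using assms(2-4) card_Diff1_less[of D 0] by simp
  then obtain z where "\<And>h. h \<in> ?H \<Longrightarrow> \<not> int n dvd idot h z"
  proof (rule ex_non_annihilator[OF \<open>prime n\<close>, rotated])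
    show "1 \<le> card {h \<in> ?H. int n dvd idot h z}" if "h \<in> ?H" "int n dvd idot h z" for h z
      using that \<open>finite D\<close> by (auto simp: Suc_le_eq card_gt_0_iff)
  qed (use assms in \<open>auto intro!: not_dvd_of_small_component\<close>)
  then have "int n dvd idot h z \<longleftrightarrow> h = 0" if "h \<in> D" for h
    using that by (cases "h = 0") (auto simp: idot_def)
  then show ?thesis using that by blast
qed

lemma ex_separating_vector_symmetric:
  fixes D :: "(int^'d) set"
  assumes "prime n" "finite D" "0 \<in> D" "card D \<le> 2 * n"
    and sym: "\<And>h. h \<in> D \<Longrightarrow> - h \<in> D"
    and D: "\<And>h j. h \<in> D \<Longrightarrow> \<bar>h $ j\<bar> < int n"
  obtains z where "\<And>h. h \<in> D \<Longrightarrow> int n dvd idot h z \<longleftrightarrow> h = 0"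
proof -
  let ?H = "D - {0}"
  have "card ?H < 2 * n"
    using assms(2-4) card_Diff1_less[of D 0] by simp
  then obtain z where "\<And>h. h \<in> ?H \<Longrightarrow> \<not> int n dvd idot h z"
  proof (rule ex_non_annihilator[OF \<open>prime n\<close>, rotated])
    fix h z assume h: "h \<in> ?H" "int n dvd idot h z"
    then have "- h \<noteq> h" by (simp add: vec_uminus_eq_self_iff)
    then have "2 = card {h, - h}" by simp
    also have "\<dots> \<le> card {h \<in> ?H. int n dvd idot h z}"
      using h sym \<open>finite D\<close> by (intro card_mono) (auto simp: idot_uminus)
    finally show "2 \<le> card {h \<in> ?H. int n dvd idot h z}" .
  qed (use assms in \<open>auto intro!: not_dvd_of_small_component\<close>)
  then have "int n dvd idot h z \<longleftrightarrow> h = 0" if "h \<in> D" for h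
    using that by (cases "h = 0") (auto simp: idot_def)
  then show ?thesis using that by blast
qed


section \<open>Sign orbits of multi-indices\<close>

text \<open>The mirror images of a single index, as a set of frequencies instead of a set of signs: a
  zero component then counts once, and components range over their values independently, so
  that sums over an orbit factor into products.\<close>

definition orbit :: "int^'d \<Rightarrow> (int^'d) set" where
  "orbit k = {h. \<forall>j. h $ j = k $ j \<or> h $ j = - k $ j}"

lemma orbit_iff_abs: "h \<in> orbit k \<longleftrightarrow> (\<forall>j. \<bar>h $ j\<bar> = \<bar>k $ j\<bar>)"
  by (auto simp: orbit_def abs_eq_iff)

lemma orbit_self [simp]: "k \<in> orbit k"
  and orbit_uminus: "h \<in> orbit k \<Longrightarrow> - h \<in> orbit k"
  by (auto simp: orbit_iff_abs)


text \<open>An orbit is a product of the sets \<open>{k $ j, - k $ j}\<close>; this form feeds \<open>prod_sum_PiE\<close>.\<close>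

lemma sum_orbit:
  fixes k :: "int^'d" and F :: "int^'d \<Rightarrow> 'a::comm_monoid_add"
  shows "sum F (orbit k) = (\<Sum>g\<in>(\<Pi>\<^sub>E j\<in>UNIV. {k $ j, - k $ j}). F (vec_lambda g))"
proof (rule sum.reindex_bij_witness[of _ vec_lambda vec_nth])
  fix h :: "int^'d" assume "h \<in> orbit k"
  then show "vec_nth h \<in> (\<Pi>\<^sub>E j\<in>UNIV. {k $ j, - k $ j})" by (auto simp: orbit_def)
qed (auto simp: orbit_def Pi_iff PiE_def)

lemma prod_if_nonzero: "(\<Prod>j\<in>UNIV. if k $ j = 0 then 1 else c) = c ^ nnz k" for c :: "'a::comm_semiring_1"
proof -
  have "{j. \<not> P j} = - {j. P j}" for P :: "'b \<Rightarrow> bool" by auto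
  then show ?thesis by (simp add: prod.If_cases nnz_def Compl_eq)
qed

lemma finite_orbit [simp]: "finite (orbit k)"
proof -
  have "orbit k \<subseteq> {h. \<forall>j. h $ j \<in> (\<Union>j. {k $ j, - k $ j})}" by (auto simp: orbit_def)
  then show ?thesis by (rule finite_subset) (rule finite_vectors_over, simp)
qed

lemma card_orbit: "card (orbit k) = 2 ^ nnz k"
proof -
  have "card (orbit k) = (\<Sum>g\<in>(\<Pi>\<^sub>E j\<in>UNIV. {k $ j, - k $ j}). 1)"
    using sum_orbit[of "\<lambda>_. 1::nat" k] by simp
  also have "\<dots> = (\<Prod>j\<in>UNIV. if k $ j = 0 then 1 else 2)"
    by (simp add: card_PiE, intro prod.cong) auto
  finally show ?thesis by (simp add: prod_if_nonzero)
qed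

lemma orbit_disjoint:
  assumes "h \<in> orbit k" "h \<in> orbit k'" "k \<in> nonneg_indices" "k' \<in> nonneg_indices"
  shows "k = k'"
proof -
  have "k $ j = k' $ j" for j
    using assms unfolding orbit_iff_abs nonneg_indices_def mem_Collect_eq by (metis abs_of_nonneg)
  then show ?thesis by (simp add: vec_eq_iff)
qed

lemma mirror_eq_UN_orbit: "mirror \<Lambda> = (\<Union>k\<in>\<Lambda>. orbit k)"
proof (intro equalityI subsetI)
  fix h assume "h \<in> mirror \<Lambda>"
  then obtain \<sigma> k where "h = flip \<sigma> k" "k \<in> \<Lambda>" "\<sigma> \<in> signs" unfolding mirror_def by blast
  then show "h \<in> (\<Union>k\<in>\<Lambda>. orbit k)"
    by (force simp: flip_def signs_def orbit_def)
next
  fix h assume "h \<in> (\<Union>k\<in>\<Lambda>. orbit k)"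
  then obtain k where k: "k \<in> \<Lambda>" "h \<in> orbit k" by blast
  define \<sigma> :: "int^'a" where "\<sigma> = (\<chi> j. if h $ j = k $ j then 1 else - 1)"
  have "h = flip \<sigma> k" "\<sigma> \<in> signs"
    using k(2) by (auto simp: \<sigma>_def flip_def signs_def orbit_def vec_eq_iff)
  then show "h \<in> mirror \<Lambda>" using k(1) unfolding mirror_def by blast
qed

text \<open>Forcing the sign \<open>+1\<close> on zero components removes exactly the ambiguity of \<open>flip\<close>, so the
  constant \<open>c\<^sub>k\<close>, defined by counting signs, counts frequencies of the orbit.\<close>

lemma bij_betw_signs_for_orbit: "bij_betw (\<lambda>\<sigma>. flip \<sigma> k) (signs_for k) (orbit k)"
proof (rule bij_betw_byWitness[where f' = "\<lambda>h. \<chi> j. if h $ j = k $ j then 1 else - 1"])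
  show "\<forall>\<sigma>\<in>signs_for k. (\<chi> j. if flip \<sigma> k $ j = k $ j then 1 else - 1) = \<sigma>"
    by (auto simp: signs_for_def signs_def flip_def vec_eq_iff)
  have "flip (\<chi> j. if h $ j = k $ j then 1 else - 1) k $ j = h $ j
      \<and> (k $ j = 0 \<longrightarrow> h $ j = k $ j)" if "h \<in> orbit k" for h j
    using that[unfolded orbit_def mem_Collect_eq, rule_format, of j] by (auto simp: flip_def)
  then show "\<forall>h\<in>orbit k. flip (\<chi> j. if h $ j = k $ j then 1 else - 1) k = h"
    and "(\<lambda>h. \<chi> j. if h $ j = k $ j then 1 else - 1) ` orbit k \<subseteq> signs_for k"
    by (auto simp: vec_eq_iff signs_for_def signs_def; metis)+
qed (auto simp: signs_for_def signs_def flip_def orbit_def)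

lemma c_const_PlanC:
  "c_const PlanC n z k = card {h \<in> orbit k. int n dvd idot (h - k) z}"
proof -
  have "bij_betw (\<lambda>\<sigma>. flip \<sigma> k)
      {\<sigma> \<in> signs_for k. idot (flip \<sigma> k) z mod int n = idot k z mod int n}
      {h \<in> orbit k. int n dvd idot (h - k) z}"
  proof (rule bij_betw_subset[OF bij_betw_signs_for_orbit])
    have *: "idot (h - k) z = idot h z - idot k z" for h
      by (simp add: idot_def left_diff_distrib sum_subtractf)
    show "(\<lambda>\<sigma>. flip \<sigma> k) ` {\<sigma> \<in> signs_for k. idot (flip \<sigma> k) z mod int n = idot k z mod int n}
        = {h \<in> orbit k. int n dvd idot (h - k) z}"
      using bij_betw_imp_surj_on[OF bij_betw_signs_for_orbit[of k]]
      by (auto simp: * mod_eq_dvd_iff)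
  qed auto
  from bij_betw_same_card[OF this] show ?thesis by (simp add: c_const_def)
qed

lemma c_const_pos: "c_const p n z k > 0"
proof (cases "p = PlanC")
  case True
  have "k \<in> {h \<in> orbit k. int n dvd idot (h - k) z}" by (simp add: idot_def)
  moreover have "finite {h \<in> orbit k. int n dvd idot (h - k) z}" by simp
  ultimately show ?thesis unfolding True c_const_PlanC card_gt_0_iff by blast
qed (simp add: c_const_def)


section \<open>Lattice rules on complex exponentials\<close>

definition character :: "int^'d \<Rightarrow> real^'d \<Rightarrow> complex" where
  "character h x = cis (2 * pi * rdot h x)"

lemma sqrt2_power_square: "sqrt 2 ^ m * sqrt 2 ^ m = 2 ^ m"
  by (simp flip: power_mult_distrib)

lemma cis_sum: "cis (sum f A) = (\<Prod>x\<in>A. cis (f x))"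
  by (induction A rule: infinite_finite_induct) (simp_all flip: cis_mult)

lemma rdot_uminus: "rdot (- h) x = - rdot h x"
  by (simp add: rdot_def sum_negf)

lemma character_mult_cnj: "character h x * cnj (character k x) = character (h - k) x"
proof -
  have "rdot (h - k) x = rdot h x - rdot k x"
    by (simp add: rdot_def left_diff_distrib sum_subtractf)
  then show ?thesis by (simp add: character_def cis_cnj cis_mult right_diff_distrib)
qed

text \<open>Each factor \<open>2 cos \<theta>\<close> is \<open>cis \<theta> + cis (-\<theta>)\<close>; multiplying out gives one character per
  element of the orbit. Components with \<open>k $ j = 0\<close> contribute the factor \<open>1\<close> on both sides.\<close>

lemma cos_prod_eq_sum_characters:
  fixes k :: "int^'d"
  shows "complex_of_real (sqrt 2 ^ nnz k * (\<Prod>j\<in>UNIV. cos (2 * pi * real_of_int (k $ j) * x $ j)))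
    = of_real (1 / sqrt 2 ^ nnz k) * (\<Sum>h\<in>orbit k. character h x)"
proof -
  have "(\<Sum>h\<in>orbit k. character h x)
      = (\<Sum>g\<in>(\<Pi>\<^sub>E j\<in>UNIV. {k $ j, - k $ j}). \<Prod>j\<in>UNIV. cis (2 * pi * real_of_int (g j) * x $ j))"
    by (simp add: sum_orbit character_def rdot_def sum_distrib_left cis_sum mult.assoc)
  also have "\<dots> = (\<Prod>j\<in>UNIV. \<Sum>m\<in>{k $ j, - k $ j}. cis (2 * pi * real_of_int m * x $ j))"
    by (rule prod_sum_PiE[symmetric]) auto
  also have "\<dots> = (\<Prod>j\<in>UNIV. (if k $ j = 0 then 1 else 2) * of_real (cos (2 * pi * real_of_int (k $ j) * x $ j)))"
    by (rule prod.cong) (auto simp: complex_eq_iff)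
  also have "\<dots> = 2 ^ nnz k * (\<Prod>j\<in>UNIV. of_real (cos (2 * pi * real_of_int (k $ j) * x $ j)))"
    by (simp add: prod.distrib prod_if_nonzero)
  finally have *: "(\<Sum>h\<in>orbit k. character h x)
      = of_real (2 ^ nnz k * (\<Prod>j\<in>UNIV. cos (2 * pi * real_of_int (k $ j) * x $ j)))"
    by simp
  have "(2::real) ^ nnz k = sqrt 2 ^ nnz k * sqrt 2 ^ nnz k"
    by (simp only: sqrt2_power_square)
  then show ?thesis unfolding * of_real_mult[symmetric] of_real_eq_iff by simp
qed


text \<open>Along the lattice points a character runs through the powers of one \<open>n\<close>-th root of unity,
  because reducing \<open>i z\<close> modulo \<open>n\<close> changes the phase by a multiple of \<open>2\<pi>\<close>.\<close>

lemma lattice_rule_character: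
  fixes h z :: "int^'d"
  assumes "n \<ge> 1"
  shows "lattice_rule n z (character h) = (if int n dvd idot h z then 1 else 0)"
proof -
  define w where "w = cis (2 * pi * (real_of_int (idot h z) / real n))"
  have n0: "real n \<noteq> 0" using assms by simp
  have point: "character h (lattice_point n z i) = w ^ i" for i
  proof -
    \<comment> \<open>the integer by which reduction modulo \<open>n\<close> shifts the phase\<close>
    define q where "q = (\<Sum>j\<in>UNIV. h $ j * ((int i * z $ j) div int n))"
    have "h $ j * ((int i * z $ j) mod int n)
        = int i * (h $ j * z $ j) - int n * (h $ j * ((int i * z $ j) div int n))" for j
      unfolding minus_mult_div_eq_mod[of "int i * z $ j" "int n", symmetric]
      by (simp only: right_diff_distrib mult.left_commute)
    then have "(\<Sum>j\<in>UNIV. h $ j * ((int i * z $ j) mod int n)) = int i * idot h z - int n * q"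
      by (simp add: q_def idot_def sum_distrib_left sum_subtractf)
    then have "real_of_int (\<Sum>j\<in>UNIV. h $ j * ((int i * z $ j) mod int n))
        = real i * real_of_int (idot h z) - real n * real_of_int q"
      by (simp del: of_int_sum)
    moreover have "rdot h (lattice_point n z i)
        = real_of_int (\<Sum>j\<in>UNIV. h $ j * ((int i * z $ j) mod int n)) / real n"
      by (simp add: rdot_def lattice_point_def sum_divide_distrib)
    ultimately have "rdot h (lattice_point n z i)
        = real i * (real_of_int (idot h z) / real n) - real_of_int q"
      using n0 by (simp add: diff_divide_distrib)
    then have "character h (lattice_point n z i)
        = cis (real i * (2 * pi * (real_of_int (idot h z) / real n))) * cis (- (2 * pi * real_of_int q))"
      by (simp only: character_def cis_mult) (simp add: algebra_simps)
    also have "cis (- (2 * pi * real_of_int q)) = 1"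
      using cis_multiple_2pi[of "- real_of_int q"] by simp
    finally show ?thesis by (simp only: w_def Complex.DeMoivre mult_1_right)
  qed
  have "w ^ n = cis (2 * pi * real_of_int (idot h z))"
    using n0 by (simp add: w_def Complex.DeMoivre)
  also have "\<dots> = 1" by (rule cis_multiple_2pi) simp
  finally have wn: "w ^ n = 1" .
  have w1: "w = 1 \<longleftrightarrow> int n dvd idot h z"
  proof
    assume "w = 1"
    then obtain m :: int where "2 * pi * (real_of_int (idot h z) / real n) = of_int m * (2 * pi)"
      unfolding w_def cis_conv_exp exp_eq_1 by auto
    then have "real_of_int (idot h z) = real_of_int (int n * m)" using n0 by (simp add: field_simps)
    then show "int n dvd idot h z" by (metis dvd_triv_left of_int_eq_iff)
  next
    assume "int n dvd idot h z"
    then obtain m where "idot h z = int n * m" by blast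
    then have "w = cis (2 * pi * real_of_int m)" using n0 by (simp add: w_def)
    also have "\<dots> = 1" by (rule cis_multiple_2pi) simp
    finally show "w = 1" .
  qed
  have "lattice_rule n z (character h) = (\<Sum>i<n. w ^ i) / of_nat n"
    by (simp add: lattice_rule_def point)
  then show ?thesis
    using wn n0 by (auto simp: geometric_sum simp flip: w1)
qed

text \<open>When \<open>z\<close> separates the frequencies, the scalar product of two character sums only sees the
  frequencies that they share. All scalar products of the functions \<open>u\<^sub>k\<close> and \<open>v\<^sub>k\<close> are instances.\<close>

lemma lattice_rule_character_sums:
  fixes z :: "int^'d" and a b :: real
  assumes "n \<ge> 1" "finite A" "finite B"
    and sep: "\<And>h k. h \<in> A \<Longrightarrow> k \<in> B \<Longrightarrow> int n dvd idot (h - k) z \<longleftrightarrow> h = k"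
  shows "lattice_rule n z (\<lambda>x. (of_real a * (\<Sum>h\<in>A. character h x)) * cnj (of_real b * (\<Sum>k\<in>B. character k x)))
    = of_real (a * b * real (card (A \<inter> B)))"
proof -
  have "lattice_rule n z (\<lambda>x. (of_real a * (\<Sum>h\<in>A. character h x)) * cnj (of_real b * (\<Sum>k\<in>B. character k x)))
    = lattice_rule n z (\<lambda>x. of_real (a * b) * (\<Sum>h\<in>A. \<Sum>k\<in>B. character (h - k) x))"
    by (simp add: sum_product mult_ac flip: character_mult_cnj)
  also have "\<dots> = of_real (a * b) * (\<Sum>h\<in>A. \<Sum>k\<in>B. lattice_rule n z (character (h - k)))"
  proof -
    have "(\<Sum>i<n. \<Sum>h\<in>A. \<Sum>k\<in>B. character (h - k) (lattice_point n z i))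
        = (\<Sum>h\<in>A. \<Sum>k\<in>B. \<Sum>i<n. character (h - k) (lattice_point n z i))"
      by (subst sum.swap) (intro sum.cong refl sum.swap)
    then show ?thesis
      by (simp add: lattice_rule_def flip: sum_distrib_left sum_divide_distrib)
  qed
  also have "(\<Sum>h\<in>A. \<Sum>k\<in>B. lattice_rule n z (character (h - k))) = (\<Sum>h\<in>A. \<Sum>k\<in>B. if h = k then 1 else 0)"
    by (intro sum.cong refl) (simp add: lattice_rule_character[OF \<open>n \<ge> 1\<close>] sep)
  also have "\<dots> = of_real (real (card (A \<inter> B)))"
    using assms(2,3) by (simp add: sum.delta' sum.If_cases Int_def)
  finally show ?thesis by simp
qed


section \<open>The transplanted functions as sums of characters\<close>

lemma lattice_rule_cong:
  assumes "\<And>i. f (lattice_point n z i) = g (lattice_point n z i)"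
  shows "lattice_rule n z f = lattice_rule n z g"
  by (simp add: lattice_rule_def assms)

lemma lattice_point_in_box:
  assumes "n \<ge> 1"
  shows "lattice_point n z i \<in> cbox (vec 0) (vec 1)"
proof -
  have "real_of_int (int i * z $ j mod int n) \<le> real n" for j
    using pos_mod_bound[of "int n" "int i * z $ j"] assms by linarith
  then show ?thesis
    using assms by (auto simp: mem_box_cart lattice_point_def divide_le_eq_1)
qed

lemma tent_bounds: "0 \<le> x \<Longrightarrow> x \<le> 1 \<Longrightarrow> 0 \<le> tent x \<and> tent x \<le> 1"
  by (auto simp: tent_def abs_if)

text \<open>The tent transform folds \<open>[0,1]\<close> onto itself twice; the cosine of integer frequency is
  symmetric about \<open>x = 1/2\<close>, so folding only doubles the frequency.\<close>

lemma cos_int_tent: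
  assumes "0 \<le> x" "x \<le> 1"
  shows "cos (pi * real_of_int m * tent x) = cos (2 * pi * real_of_int m * x)"
proof (cases "x \<le> 1 / 2")
  case True
  then have "tent x = 2 * x" by (simp add: tent_def)
  then show ?thesis by (simp add: mult_ac)
next
  case False
  then have "pi * real_of_int m * tent x = 2 * pi * real_of_int m - 2 * pi * real_of_int m * x"
    by (simp add: tent_def abs_if algebra_simps)
  then show ?thesis by (simp add: cos_diff cos_int_2pin sin_int_2pin)
qed

lemma u_fun_Fourier: "u_fun Fourier k x = character k x"
  by (simp add: u_fun_def character_def cis_conv_exp mult_ac)

lemma u_fun_eq_orbit_sum:
  assumes "s \<noteq> Fourier" "x \<in> cbox (vec 0) (vec 1)"
  shows "u_fun s k x = of_real (1 / sqrt 2 ^ nnz k) * (\<Sum>h\<in>orbit k. character h x)"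
proof -
  have x: "0 \<le> x $ j \<and> x $ j \<le> 1" for j using assms(2) by (simp add: mem_box_cart)
  have "u_fun s k x = of_real (sqrt 2 ^ nnz k * (\<Prod>j\<in>UNIV. cos (2 * pi * real_of_int (k $ j) * x $ j)))"
  proof (cases s)
    case (Cosine p)
    then show ?thesis using x by (simp add: u_fun_def cos_int_tent)
  next
    case (Chebyshev p)
    have "arccos (cos (pi * tent (x $ j))) = pi * tent (x $ j)" for j
      using tent_bounds[of "x $ j"] x by (intro arccos_cos) (auto simp: mult_le_cancel_left1)
    moreover have "cos (real_of_int (k $ j) * (pi * tent (x $ j))) = cos (2 * pi * real_of_int (k $ j) * x $ j)" for j
      using cos_int_tent[of "x $ j" "k $ j"] x[of j] by (simp only: mult_ac)
    ultimately show ?thesis using Chebyshev by (simp add: u_fun_def)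
  qed (use assms in simp)
  then show ?thesis by (simp only: cos_prod_eq_sum_characters)
qed

text \<open>The factor that turns the sum of characters over \<open>{k, - k}\<close> into \<open>v\<^sub>k\<close> for plans B and C. The
  case \<open>k = 0\<close> differs since the pair collapses to one frequency.\<close>

definition pair_weight :: "int^'d \<Rightarrow> real" where
  "pair_weight k = (if k = 0 then 1 else sqrt 2 ^ nnz k / 2)"

lemma nnz_0 [simp]: "nnz 0 = 0"
  by (simp add: nnz_def)

lemma nnz_pos: "k \<noteq> 0 \<Longrightarrow> nnz k > 0"
  by (auto simp: nnz_def card_gt_0_iff vec_eq_iff)

lemma real_d_const:
  assumes "p \<noteq> PlanA"
  shows "real (d_const p k) = (if k = 0 then 1 else 2 ^ (nnz k - 1))"
proof (cases "k = 0")
  case True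
  then show ?thesis by (simp add: d_const_def)
next
  case False
  then have "d_const p k = 2 ^ (nnz k - 1)"
    unfolding d_const_def using assms by (simp only: simp_thms if_True not_False_eq_True)
  then show ?thesis using False by (simp only: of_nat_power of_nat_numeral if_False)
qed

lemma card_pair: "card {k, - k} = (if k = 0 then 1 else 2)" for k :: "int^'d"
  using vec_uminus_eq_self_iff[of k] by auto

lemma pair_weight_square:
  "pair_weight k * pair_weight k * real (card {k, - k}) = (if k = 0 then 1 else 2 ^ (nnz k - 1))"
proof (cases "k = 0")
  case False
  have "pair_weight k * pair_weight k * real (card {k, - k}) = (sqrt 2 ^ nnz k * sqrt 2 ^ nnz k) / 2"
    using False by (simp add: card_pair pair_weight_def)
  also have "\<dots> = 2 ^ nnz k / 2" by (simp only: sqrt2_power_square)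
  also have "\<dots> = 2 ^ (nnz k - 1)"
    using nnz_pos[OF False] by (simp add: power_diff)
  finally show ?thesis using False by simp
qed (simp add: pair_weight_def)

lemma pair_subset_orbit: "{k, - k} \<subseteq> orbit k"
  using orbit_self[of k] orbit_uminus[OF orbit_self, of k] by simp

text \<open>The value of \<open>Q\<^sub>n(v\<^sub>k v\<^sub>k')\<close> by counting common frequencies. Different nonnegative indices
  share none, since the pair of an index lies in its orbit.\<close>

lemma pair_weight_orthogonal:
  assumes "k \<in> nonneg_indices" "k' \<in> nonneg_indices" "p \<noteq> PlanA"
  shows "pair_weight k * pair_weight k' * real (card ({k, - k} \<inter> {k', - k'}))
    = (if k = k' then real (d_const p k) else 0)"
proof (cases "k = k'")
  case True
  have "pair_weight k * pair_weight k * real (card ({k, - k} \<inter> {k, - k})) = real (d_const p k)"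
    by (simp only: Int_absorb pair_weight_square real_d_const[OF assms(3)])
  then show ?thesis unfolding True by (simp only: refl if_True)
next
  case False
  have "{k, - k} \<inter> {k', - k'} \<subseteq> orbit k \<inter> orbit k'"
    by (rule Int_mono[OF pair_subset_orbit pair_subset_orbit])
  also have "\<dots> = {}" using orbit_disjoint[OF _ _ assms(1,2)] False by blast
  finally have "card ({k, - k} \<inter> {k', - k'}) = 0" by (simp only: subset_empty card.empty)
  then show ?thesis using False by (simp only: if_False of_nat_0 mult_zero_right)
qed

lemma v_fun_eq_pair_sum:
  assumes "plan_of s \<noteq> PlanA"
  shows "v_fun s k x = of_real (pair_weight k) * (\<Sum>h\<in>{k, - k}. character h x)"
proof (cases "k = 0")
  case True
  then show ?thesis using assms by (simp add: v_fun_def pair_weight_def character_def rdot_def)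
next
  case False
  then have "k \<noteq> - k" using vec_uminus_eq_self_iff by metis
  then have "(\<Sum>h\<in>{k, - k}. character h x) = of_real (2 * cos (2 * pi * rdot k x))"
    by (simp add: character_def rdot_uminus complex_eq_iff)
  then show ?thesis using False assms by (simp add: v_fun_def pair_weight_def)
qed


section \<open>Admissible generating vectors\<close>

lemma admissible_Fourier:
  assumes "n \<ge> 1" and sep: "\<And>h. h \<in> set_diff \<Lambda> \<Lambda> \<Longrightarrow> int n dvd idot h z \<longleftrightarrow> h = 0"
  shows "admissible Fourier n \<Lambda> z"
proof -
  have "lattice_rule n z (\<lambda>x. u_fun Fourier k x * cnj (u_fun Fourier k' x)) = (if k = k' then 1 else 0)"
    if "k \<in> \<Lambda>" "k' \<in> \<Lambda>" for k k'
  proof -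
    have "k - k' \<in> set_diff \<Lambda> \<Lambda>" using that by (auto simp: set_diff_def)
    then show ?thesis
      by (simp add: u_fun_Fourier character_mult_cnj lattice_rule_character[OF \<open>n \<ge> 1\<close>] sep)
  qed
  moreover have "v_fun Fourier k x = u_fun Fourier k x" for k :: "int^'a" and x
    by (simp add: v_fun_def)
  ultimately show ?thesis
    by (simp add: admissible_def c_const_def d_const_def)
qed

text \<open>An orbit has \<open>2 ^ nnz k\<close> elements, which cancels the two normalising factors; and since orbits
  are closed under negation, differences of frequencies lie in \<open>\<M>(\<Lambda>) \<oplus> \<M>(\<Lambda>)\<close>.\<close>

lemma admissible_PlanA:
  assumes "n \<ge> 1" "s \<noteq> Fourier" "plan_of s = PlanA" "\<Lambda> \<subseteq> nonneg_indices"
    and sep: "\<And>h. h \<in> set_sum (mirror \<Lambda>) (mirror \<Lambda>) \<Longrightarrow> int n dvd idot h z \<longleftrightarrow> h = 0"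
  shows "admissible s n \<Lambda> z"
proof -
  have "lattice_rule n z (\<lambda>x. u_fun s k x * cnj (u_fun s k' x)) = (if k = k' then 1 else 0)"
    if k: "k \<in> \<Lambda>" "k' \<in> \<Lambda>" for k k'
  proof -
    have "lattice_rule n z (\<lambda>x. u_fun s k x * cnj (u_fun s k' x))
      = lattice_rule n z (\<lambda>x. (of_real (1 / sqrt 2 ^ nnz k) * (\<Sum>h\<in>orbit k. character h x))
          * cnj (of_real (1 / sqrt 2 ^ nnz k') * (\<Sum>h\<in>orbit k'. character h x)))"
      by (intro lattice_rule_cong)
         (simp only: u_fun_eq_orbit_sum[OF \<open>s \<noteq> Fourier\<close> lattice_point_in_box[OF \<open>n \<ge> 1\<close>]])
    also have "\<dots> = of_real (1 / sqrt 2 ^ nnz k * (1 / sqrt 2 ^ nnz k') * real (card (orbit k \<inter> orbit k')))"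
    proof (rule lattice_rule_character_sums[OF \<open>n \<ge> 1\<close>])
      fix h h' assume "h \<in> orbit k" "h' \<in> orbit k'"
      then have "h \<in> mirror \<Lambda>" "- h' \<in> mirror \<Lambda>"
        using k orbit_uminus by (auto simp: mirror_eq_UN_orbit)
      then have "h - h' \<in> set_sum (mirror \<Lambda>) (mirror \<Lambda>)"
        unfolding set_sum_def mem_Collect_eq by (metis diff_conv_add_uminus)
      then show "int n dvd idot (h - h') z \<longleftrightarrow> h = h'" using sep by simp
    qed auto
    also have "\<dots> = (if k = k' then 1 else 0)"
    proof (cases "k = k'")
      case True
      have "1 / a * (1 / a) * (a * a) = 1" if "a \<noteq> 0" for a :: real using that by simp
      from this[of "sqrt 2 ^ nnz k"]
      have "1 / sqrt 2 ^ nnz k * (1 / sqrt 2 ^ nnz k) * real (card (orbit k)) = 1"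
        unfolding sqrt2_power_square by (simp add: card_orbit)
      then show ?thesis unfolding True[symmetric] Int_absorb by (simp only: of_real_1 refl if_True)
    next
      case False
      then have "orbit k \<inter> orbit k' = {}" using orbit_disjoint k assms(4) by blast
      then show ?thesis using False by simp
    qed
    finally show ?thesis .
  qed
  moreover have "v_fun s k x = u_fun s k x" for k :: "int^'a" and x
    using assms(3) by (simp add: v_fun_def)
  ultimately show ?thesis
    by (simp add: admissible_def c_const_def d_const_def assms(3))
qed

text \<open>The orbit of \<open>k\<close> contains both frequencies of \<open>v\<^sub>k\<close>. For \<open>k \<noteq> 0\<close> these are two frequencies,
  and their number cancels the \<open>1/2\<close> in \<open>pair_weight\<close>.\<close>

lemma lattice_rule_u_v:
  assumes "n \<ge> 1" "plan_of s \<noteq> PlanA" "k \<in> nonneg_indices" "k' \<in> nonneg_indices"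
    and sep: "\<And>h h'. h \<in> orbit k \<Longrightarrow> h' \<in> {k', - k'} \<Longrightarrow> int n dvd idot (h - h') z \<longleftrightarrow> h = h'"
  shows "lattice_rule n z (\<lambda>x. u_fun s k x * cnj (v_fun s k' x)) = (if k = k' then 1 else 0)"
proof -
  have "s \<noteq> Fourier" using assms(2) by auto
  have "lattice_rule n z (\<lambda>x. u_fun s k x * cnj (v_fun s k' x))
    = lattice_rule n z (\<lambda>x. (of_real (1 / sqrt 2 ^ nnz k) * (\<Sum>h\<in>orbit k. character h x))
        * cnj (of_real (pair_weight k') * (\<Sum>h\<in>{k', - k'}. character h x)))"
    by (intro lattice_rule_cong)
       (simp only: v_fun_eq_pair_sum[OF assms(2)]
          u_fun_eq_orbit_sum[OF \<open>s \<noteq> Fourier\<close> lattice_point_in_box[OF \<open>n \<ge> 1\<close>]])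
  also have "\<dots> = of_real (1 / sqrt 2 ^ nnz k * pair_weight k' * real (card (orbit k \<inter> {k', - k'})))"
    by (rule lattice_rule_character_sums[OF \<open>n \<ge> 1\<close> _ _ sep]) simp_all
  also have "\<dots> = (if k = k' then 1 else 0)"
  proof (cases "k = k'")
    case True
    have "orbit k \<inter> {k, - k} = {k, - k}" using pair_subset_orbit[of k] by (rule Int_absorb1)
    then show ?thesis unfolding True[symmetric] by (simp add: card_pair pair_weight_def)
  next
    case False
    have "orbit k \<inter> {k', - k'} \<subseteq> orbit k \<inter> orbit k'"
      by (rule Int_mono[OF order_refl pair_subset_orbit])
    also have "\<dots> = {}" using orbit_disjoint[OF _ _ assms(3,4)] False by blast
    finally have "card (orbit k \<inter> {k', - k'}) = 0" by (simp only: subset_empty card.empty)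
    then show ?thesis using False by (simp only: if_False of_nat_0 mult_zero_right of_real_0)
  qed
  finally show ?thesis .
qed

lemma lattice_rule_v_v:
  assumes "n \<ge> 1" "plan_of s \<noteq> PlanA" "k \<in> nonneg_indices" "k' \<in> nonneg_indices"
    and sep: "\<And>h h'. h \<in> {k, - k} \<Longrightarrow> h' \<in> {k', - k'} \<Longrightarrow> int n dvd idot (h - h') z \<longleftrightarrow> h = h'"
  shows "lattice_rule n z (\<lambda>x. v_fun s k x * cnj (v_fun s k' x))
    = (if k = k' then of_nat (d_const (plan_of s) k) else 0)"
proof -
  have "lattice_rule n z (\<lambda>x. v_fun s k x * cnj (v_fun s k' x))
    = of_real (pair_weight k * pair_weight k' * real (card ({k, - k} \<inter> {k', - k'})))"
    unfolding v_fun_eq_pair_sum[OF assms(2)]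
    by (rule lattice_rule_character_sums[OF \<open>n \<ge> 1\<close> _ _ sep]) simp_all
  also have "\<dots> = of_real (if k = k' then real (d_const (plan_of s) k) else 0)"
    by (simp only: pair_weight_orthogonal[OF assms(3,4,2)])
  also have "\<dots> = (if k = k' then of_nat (d_const (plan_of s) k) else 0)" by simp
  finally show ?thesis .
qed

text \<open>Up to sign every difference of frequencies met here lies in \<open>\<Lambda> \<oplus> \<M>(\<Lambda>)\<close>, including those
  between an index and its own mirror images. The latter force \<open>c\<^sub>k = 1\<close> for plan C too, so both
  plans have the same scalar products.\<close>

lemma admissible_PlanBC:
  assumes "n \<ge> 1" "plan_of s \<noteq> PlanA" "\<Lambda> \<subseteq> nonneg_indices"
    and sep: "\<And>h. h \<in> set_sum \<Lambda> (mirror \<Lambda>) \<Longrightarrow> int n dvd idot h z \<longleftrightarrow> h = 0"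
  shows "admissible s n \<Lambda> z"
proof -
  have dvd_iff: "int n dvd idot (h - h') z \<longleftrightarrow> h = h'"
    if mem: "k \<in> \<Lambda>" "k' \<in> \<Lambda>" "h \<in> orbit k" "h' \<in> {k', - k'}" for h h' k k'
  proof -
    have h: "h \<in> mirror \<Lambda>" "- h \<in> mirror \<Lambda>"
      using mem orbit_uminus by (auto simp: mirror_eq_UN_orbit)
    consider "h' = k'" | "h' = - k'" using mem(4) by blast
    then show ?thesis
    proof cases
      case 1
      have "k' + (- h) \<in> set_sum \<Lambda> (mirror \<Lambda>)" using h(2) mem(2) unfolding set_sum_def by blast
      moreover have "idot (h - h') z = - idot (k' + (- h)) z"
        using idot_uminus[of "k' + (- h)" z] 1 by simp
      moreover have "k' + (- h) = 0 \<longleftrightarrow> h = h'" using 1 by auto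
      ultimately show ?thesis using sep[of "k' + (- h)"] by (simp only: dvd_minus_iff)
    next
      case 2
      have "k' + h \<in> set_sum \<Lambda> (mirror \<Lambda>)" using h(1) mem(2) unfolding set_sum_def by blast
      moreover have "h - h' = k' + h" by (simp add: 2)
      ultimately show ?thesis using sep[of "k' + h"] by (metis right_minus_eq)
    qed
  qed
  have uv: "lattice_rule n z (\<lambda>x. u_fun s k x * cnj (v_fun s k' x)) = (if k = k' then 1 else 0)"
    and vv: "lattice_rule n z (\<lambda>x. v_fun s k x * cnj (v_fun s k' x))
      = (if k = k' then of_nat (d_const (plan_of s) k) else 0)"
    if k: "k \<in> \<Lambda>" "k' \<in> \<Lambda>" for k k'
  proof -
    have kn: "k \<in> nonneg_indices" "k' \<in> nonneg_indices" using k assms(3) by blast+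
    show "lattice_rule n z (\<lambda>x. u_fun s k x * cnj (v_fun s k' x)) = (if k = k' then 1 else 0)"
      by (rule lattice_rule_u_v[OF assms(1,2) kn dvd_iff[OF k]])
    show "lattice_rule n z (\<lambda>x. v_fun s k x * cnj (v_fun s k' x))
      = (if k = k' then of_nat (d_const (plan_of s) k) else 0)"
      by (rule lattice_rule_v_v[OF assms(1,2) kn dvd_iff[OF k subsetD[OF pair_subset_orbit]]])
  qed
  have "c_const (plan_of s) n z k = 1" if "k \<in> \<Lambda>" for k
  proof (cases "plan_of s = PlanC")
    case True
    have "int n dvd idot (h - k) z \<longleftrightarrow> h = k" if "h \<in> orbit k" for h
      by (rule dvd_iff[OF \<open>k \<in> \<Lambda>\<close> \<open>k \<in> \<Lambda>\<close> that]) simp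
    then have "{h \<in> orbit k. int n dvd idot (h - k) z} = {k}"
      using orbit_self[of k] by blast
    then show ?thesis by (simp add: True c_const_PlanC)
  qed (simp add: c_const_def)
  then show ?thesis unfolding admissible_def using uv vv by simp
qed


lemma abs_le_max_abs:
  assumes "finite \<Lambda>" "k \<in> \<Lambda>"
  shows "\<bar>k $ j\<bar> \<le> max_abs \<Lambda>"
proof -
  have "{\<bar>k $ j\<bar> | k j. k \<in> \<Lambda>} = (\<lambda>(k, j). \<bar>k $ j\<bar>) ` (\<Lambda> \<times> UNIV)" by auto
  then have "finite {\<bar>k $ j\<bar> | k j. k \<in> \<Lambda>}" using assms(1) by simp
  then show ?thesis unfolding max_abs_def using assms(2) by (intro Max_ge) auto
qed

lemma abs_mirror_le_max_abs:
  assumes "finite \<Lambda>" "h \<in> mirror \<Lambda>"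
  shows "\<bar>h $ j\<bar> \<le> max_abs \<Lambda>"
  using assms abs_le_max_abs by (fastforce simp: mirror_eq_UN_orbit orbit_iff_abs)

text \<open>Components of the relevant differences are at most \<open>2 max(\<Lambda>)\<close> in absolute value, so a
  modulus above that bound makes every nonzero difference nonzero modulo \<open>n\<close>.\<close>

lemma ex_admissible:
  fixes \<Lambda> :: "(int^'d) set"
  assumes "finite \<Lambda>" "\<Lambda> \<noteq> {}" "\<Lambda> \<subseteq> index_domain s" "prime n"
    and n: "real n > threshold s \<Lambda>" "real n > 2 * real_of_int (max_abs \<Lambda>)"
  shows "\<exists>z. admissible s n \<Lambda> z"
proof -
  have n1: "n \<ge> 1" using \<open>prime n\<close> prime_ge_1_nat by blast
  have bound: "2 * max_abs \<Lambda> < int n" using n(2) by linarith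
  obtain k0 where k0: "k0 \<in> \<Lambda>" using assms(2) by blast
  let ?M = "mirror \<Lambda>"
  have sub: "\<Lambda> \<subseteq> ?M" by (auto simp: mirror_eq_UN_orbit)
  have um: "- h \<in> ?M" if "h \<in> ?M" for h
    using that orbit_uminus by (auto simp: mirror_eq_UN_orbit)
  have finM: "finite ?M" using assms(1) by (simp add: mirror_eq_UN_orbit)
  have image_sum: "set_sum A B = (\<lambda>(a, b). a + b) ` (A \<times> B)" for A B :: "(int^'d) set"
    by (auto simp: set_sum_def)
  have image_diff: "set_diff A B = (\<lambda>(a, b). a - b) ` (A \<times> B)" for A B :: "(int^'d) set"
    by (auto simp: set_diff_def)
  have small: "\<bar>h $ j\<bar> < int n" if h: "h \<in> set_sum ?M ?M" for h j
  proof -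
    obtain a b where "h = a + b" "a \<in> ?M" "b \<in> ?M" using h unfolding set_sum_def by blast
    then show ?thesis
      using abs_mirror_le_max_abs[OF assms(1), of a j] abs_mirror_le_max_abs[OF assms(1), of b j] bound
      by simp
  qed
  have diff_sub: "set_diff \<Lambda> \<Lambda> \<subseteq> set_sum ?M ?M"
  proof
    fix h assume "h \<in> set_diff \<Lambda> \<Lambda>"
    then obtain a b where "h = a + (- b)" "a \<in> \<Lambda>" "b \<in> \<Lambda>" unfolding set_diff_def by auto
    then show "h \<in> set_sum ?M ?M" using sub um unfolding set_sum_def by blast
  qed
  consider "s = Fourier" | "s \<noteq> Fourier" "plan_of s = PlanA" | "s \<noteq> Fourier" "plan_of s \<noteq> PlanA"
    by blast
  then show ?thesis
  proof cases
    case 1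
    let ?D = "set_diff \<Lambda> \<Lambda>"
    obtain z where "\<And>h. h \<in> ?D \<Longrightarrow> int n dvd idot h z \<longleftrightarrow> h = 0"
    proof (rule ex_separating_vector_symmetric[OF \<open>prime n\<close>, of ?D])
      show "finite ?D" using assms(1) by (simp add: image_diff)
      show "0 \<in> ?D" using k0 unfolding set_diff_def mem_Collect_eq by (metis diff_self)
      show "card ?D \<le> 2 * n" using n(1) 1 by simp
      show "- h \<in> ?D" if "h \<in> ?D" for h
        using that unfolding set_diff_def mem_Collect_eq by (metis minus_diff_eq)
      show "\<bar>h $ j\<bar> < int n" if "h \<in> ?D" for h j using that small diff_sub by blast
    qed blast
    then show ?thesis using admissible_Fourier[OF n1] 1 by blast
  next
    case 2
    let ?D = "set_sum ?M ?M"
    have nn: "\<Lambda> \<subseteq> nonneg_indices" using assms(3) 2(1) by (cases s) auto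
    obtain z where "\<And>h. h \<in> ?D \<Longrightarrow> int n dvd idot h z \<longleftrightarrow> h = 0"
    proof (rule ex_separating_vector_symmetric[OF \<open>prime n\<close>, of ?D])
      show "finite ?D" using finM by (simp add: image_sum)
      show "0 \<in> ?D" using k0 sub um unfolding set_sum_def mem_Collect_eq
        by (metis add.right_inverse subsetD)
      show "card ?D \<le> 2 * n" using n(1) 2 by (cases s) (auto simp: plan_threshold_def)
      show "- h \<in> ?D" if "h \<in> ?D" for h
        using that um unfolding set_sum_def mem_Collect_eq by (metis minus_add_distrib)
    qed (use small in blast)+
    then show ?thesis using admissible_PlanA[OF n1 2 nn] by blast
  next
    case 3
    let ?D = "set_sum \<Lambda> ?M"
    have nn: "\<Lambda> \<subseteq> nonneg_indices" using assms(3) 3(1) by (cases s) auto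
    have D_sub: "?D \<subseteq> set_sum ?M ?M" using sub unfolding set_sum_def by blast
    have "card ?D \<le> card \<Lambda> * card ?M"
      unfolding image_sum using card_image_le[of "\<Lambda> \<times> ?M" "\<lambda>(a, b). a + b"] assms(1) finM
      by (simp add: card_cartesian_product)
    then have "real (card ?D) \<le> real (card \<Lambda> * card ?M)" by (simp only: of_nat_le_iff)
    moreover have "threshold s \<Lambda> = plan_threshold (plan_of s) \<Lambda>" using 3(1) by (cases s) auto
    ultimately have card_D: "card ?D \<le> n"
      using n(1) 3(2) by (cases "plan_of s") (auto simp: plan_threshold_def)
    obtain z where "\<And>h. h \<in> ?D \<Longrightarrow> int n dvd idot h z \<longleftrightarrow> h = 0"
    proof (rule ex_separating_vector[OF \<open>prime n\<close>, of ?D])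
      show "finite ?D" using assms(1) finM by (simp add: image_sum)
      show "0 \<in> ?D" using k0 sub um unfolding set_sum_def mem_Collect_eq
        by (metis add.right_inverse subsetD)
    qed (use small D_sub card_D in blast)+
    then show ?thesis using admissible_PlanBC[OF n1 3(2) nn] by blast
  qed
qed


section \<open>Bounds for the stability constants\<close>

lemma rho_PlanA:
  assumes "\<Lambda> \<noteq> {}"
  shows "rho PlanA n z \<Lambda> = 1"
proof -
  have "(\<lambda>k. real (d_const PlanA k) / (real (c_const PlanA n z k))\<^sup>2) ` \<Lambda> = {1}"
    using assms by (auto simp: d_const_def c_const_def)
  then show ?thesis by (simp add: rho_def)
qed

lemma rho_PlanC_le_PlanB:
  assumes "finite \<Lambda>" "\<Lambda> \<noteq> {}"
  shows "rho PlanC n z \<Lambda> \<le> rho PlanB n z \<Lambda>"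
  unfolding rho_def
proof (rule Max.boundedI)
  fix r assume "r \<in> (\<lambda>k. real (d_const PlanC k) / (real (c_const PlanC n z k))\<^sup>2) ` \<Lambda>"
  then obtain k where k: "k \<in> \<Lambda>" "r = real (d_const PlanC k) / (real (c_const PlanC n z k))\<^sup>2" by blast
  have "1 \<le> (real (c_const PlanC n z k))\<^sup>2"
    using c_const_pos[of PlanC n z k] by simp
  then have "r \<le> real (d_const PlanC k) / 1"
    unfolding k(2) using c_const_pos[of PlanC n z k]
    by (intro divide_left_mono) auto
  also have "\<dots> = real (d_const PlanB k) / (real (c_const PlanB n z k))\<^sup>2"
    by (simp add: d_const_def c_const_def)
  also have "\<dots> \<le> Max ((\<lambda>k. real (d_const PlanB k) / (real (c_const PlanB n z k))\<^sup>2) ` \<Lambda>)"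
    using k(1) assms(1) by (intro Max_ge) auto
  finally show "r \<le> Max ((\<lambda>k. real (d_const PlanB k) / (real (c_const PlanB n z k))\<^sup>2) ` \<Lambda>)" .
qed (use assms in auto)

lemma rho_PlanB_le:
  assumes "finite \<Lambda>" "\<Lambda> \<noteq> {}" "\<And>k. k \<in> \<Lambda> \<Longrightarrow> real (d_const PlanB k) \<le> b"
  shows "rho PlanB n z \<Lambda> \<le> b"
  unfolding rho_def using assms by (auto simp: c_const_def)

text \<open>Cutting off the negative components maps the orbit of \<open>k\<close> injectively into the box below \<open>k\<close>,
  which a downward closed set contains.\<close>

lemma two_power_nnz_le_card:
  assumes "downward_closed \<Lambda>" "finite \<Lambda>" "k \<in> \<Lambda>"
  shows "2 ^ nnz k \<le> card \<Lambda>"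
proof -
  define pos where "pos = (\<lambda>h::int^'a. \<chi> j. max 0 (h $ j))"
  have kn: "0 \<le> k $ j" for j
    using assms(1,3) by (auto simp: downward_closed_def nonneg_indices_def)
  have "inj_on pos (orbit k)"
  proof (rule inj_onI)
    fix h h' assume h: "h \<in> orbit k" "h' \<in> orbit k" and eq: "pos h = pos h'"
    have "h $ j = h' $ j" for j
    proof -
      have "max 0 (h $ j) = max 0 (h' $ j)" using arg_cong[OF eq, of "\<lambda>v. v $ j"] by (simp add: pos_def)
      moreover have "\<bar>h $ j\<bar> = \<bar>h' $ j\<bar>" using h by (simp add: orbit_iff_abs)
      ultimately show ?thesis by linarith
    qed
    then show "h = h'" by (simp add: vec_eq_iff)
  qed
  moreover have "pos ` orbit k \<subseteq> \<Lambda>"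
  proof (rule image_subsetI)
    fix h assume "h \<in> orbit k"
    then have "\<bar>h $ j\<bar> = \<bar>k $ j\<bar>" for j by (simp add: orbit_iff_abs)
    then have "pos h $ j \<le> k $ j" for j using kn[of j] by (simp add: pos_def) (metis abs_ge_self abs_of_nonneg)
    moreover have "pos h \<in> nonneg_indices" by (simp add: pos_def nonneg_indices_def)
    ultimately show "pos h \<in> \<Lambda>" using assms(1,3) unfolding downward_closed_def by blast
  qed
  ultimately have "card (orbit k) \<le> card \<Lambda>" using card_inj_on_le assms(2) by blast
  then show ?thesis by (simp add: card_orbit)
qed

lemma rho_PlanB_le_downward_closed:
  fixes \<Lambda> :: "(int^'d) set"
  assumes "finite \<Lambda>" "\<Lambda> \<noteq> {}" "downward_closed \<Lambda>"
  shows "rho PlanB n z \<Lambda> \<le> min (2 ^ (CARD('d) - 1)) (real (card \<Lambda>))"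
proof (rule rho_PlanB_le[OF assms(1,2)])
  fix k assume k: "k \<in> \<Lambda>"
  have "nnz k \<le> CARD('d)" unfolding nnz_def by (rule card_mono) auto
  then have "(2::real) ^ (nnz k - 1) \<le> 2 ^ (CARD('d) - 1)" by (intro power_increasing) auto
  then have 1: "real (d_const PlanB k) \<le> 2 ^ (CARD('d) - 1)" by (simp add: d_const_def)
  have "d_const PlanB k \<le> 2 ^ nnz k" by (simp add: d_const_def)
  also have "\<dots> \<le> card \<Lambda>" by (rule two_power_nnz_le_card[OF assms(3,1) k])
  finally have "real (d_const PlanB k) \<le> real (card \<Lambda>)" by simp
  with 1 show "real (d_const PlanB k) \<le> min (2 ^ (CARD('d) - 1)) (real (card \<Lambda>))" by simp
qed


section \<open>Orthonormality of the basis functions\<close>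

lemma integral_prod_vec:
  fixes f :: "'d::finite \<Rightarrow> real \<Rightarrow> 'b::{real_normed_field, banach, second_countable_topology}"
  assumes f: "\<And>j. integrable lborel (f j)"
  shows "(LINT x::real^'d|lborel. (\<Prod>j\<in>UNIV. f j (x $ j))) = (\<Prod>j\<in>UNIV. integral\<^sup>L lborel (f j))"
proof -
  interpret product_sigma_finite "\<lambda>_::real^'d. lborel :: real measure" by standard
  define T where "T = (\<lambda>g::real^'d \<Rightarrow> real. \<Sum>b\<in>Basis. g b *\<^sub>R b)"
  define F where "F = (\<lambda>b::real^'d. f (axis_index b))"
  have Basis_eq: "(Basis :: (real^'d) set) = (\<lambda>j. axis j 1) ` UNIV"
    by (auto simp: Basis_vec_def)
  have inj: "inj (\<lambda>j::'d. axis j (1::real))" by (auto simp: inj_on_def axis_eq_axis)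
  have T_nth: "T g $ j = g (axis j 1)" for g j
  proof -
    have "axis j (1::real) \<in> Basis" by simp
    then have "T g \<bullet> axis j 1 = g (axis j 1)"
      unfolding T_def by (rule inner_sum_left_Basis)
    then show ?thesis by (simp add: inner_axis)
  qed
  have prod_eq: "(\<Prod>j\<in>UNIV. f j (T g $ j)) = (\<Prod>b\<in>Basis. F b (g b))" for g
    unfolding Basis_eq prod.reindex[OF inj] by (simp add: F_def T_nth)
  have [measurable]: "f j \<in> borel_measurable borel" for j
    using borel_measurable_integrable[OF f] by simp
  have meas: "(\<lambda>x::real^'d. \<Prod>j\<in>UNIV. f j (x $ j)) \<in> borel_measurable borel"
    by measurable
  have T_meas: "T \<in> measurable (\<Pi>\<^sub>M b\<in>Basis. lborel) borel"
    unfolding T_def by measurable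
  have lb: "(lborel :: (real^'d) measure) = distr (\<Pi>\<^sub>M b\<in>Basis. lborel) borel T"
    unfolding T_def by (rule lborel_eq)
  have F: "integrable lborel (F b)" for b by (simp add: F_def f)
  have "(LINT x::real^'d|lborel. (\<Prod>j\<in>UNIV. f j (x $ j)))
      = integral\<^sup>L (\<Pi>\<^sub>M b\<in>(Basis::(real^'d) set). lborel) (\<lambda>g. \<Prod>b\<in>Basis. F b (g b))"
    unfolding lb integral_distr[OF T_meas meas] prod_eq ..
  also have "\<dots> = (\<Prod>b\<in>Basis. integral\<^sup>L lborel (F b))"
    by (rule product_integral_prod) (auto intro: F)
  also have "\<dots> = (\<Prod>j\<in>UNIV. integral\<^sup>L lborel (f j))"
    unfolding Basis_eq prod.reindex[OF inj] by (simp add: F_def)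
  finally show "(LINT x::real^'d|lborel. (\<Prod>j\<in>UNIV. f j (x $ j))) = (\<Prod>j\<in>UNIV. integral\<^sup>L lborel (f j))" .
qed

text \<open>Basis functions and densities are products over the coordinates; \<open>factor\<close> and \<open>weight\<close> are the
  one-dimensional ingredients. The cosine and Chebyshev factors are written as the cosine of
  \<open>m \<theta>\<close> with \<open>\<theta> = \<pi> t\<close> and \<open>\<theta> = arccos t\<close> respectively, so that one computation serves both.\<close>

fun factor :: "setting \<Rightarrow> int \<Rightarrow> real \<Rightarrow> complex" where
  "factor Fourier m t = cis (2 * pi * real_of_int m * t)"
| "factor (Cosine p) m t = of_real ((if m = 0 then 1 else sqrt 2) * cos (real_of_int m * (pi * t)))"
| "factor (Chebyshev p) m t = of_real ((if m = 0 then 1 else sqrt 2) * cos (real_of_int m * arccos t))"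

fun weight :: "setting \<Rightarrow> real \<Rightarrow> real" where
  "weight Fourier t = indicator {0..1} t"
| "weight (Cosine p) t = indicator {0..1} t"
| "weight (Chebyshev p) t = indicator {-1..1} t * (1 / (pi * sqrt (1 - t\<^sup>2)))"

lemma alpha_eq_prod: "alpha s k x = (\<Prod>j\<in>UNIV. factor s (k $ j) (x $ j))"
proof (cases s)
  case Fourier
  have "alpha s k x = cis (\<Sum>j\<in>UNIV. 2 * pi * real_of_int (k $ j) * x $ j)"
    by (simp add: Fourier cis_conv_exp rdot_def sum_distrib_left mult_ac)
  then show ?thesis by (simp add: Fourier cis_sum)
next
  case (Cosine p)
  then show ?thesis by (simp add: prod.distrib prod_if_nonzero mult_ac flip: of_real_prod)
next
  case (Chebyshev p)
  then show ?thesis by (simp add: prod.distrib prod_if_nonzero mult_ac flip: of_real_prod)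
qed

lemma has_bochner_integral_cis:
  "has_bochner_integral lborel (\<lambda>t. indicator {0..1} t *\<^sub>R cis (2 * pi * real_of_int m * t)) (if m = 0 then 1 else 0)"
proof (cases "m = 0")
  case True
  have "has_bochner_integral lborel (\<lambda>t::real. indicator {0..1} t *\<^sub>R (1::complex)) (of_real 1 - of_real 0)"
    by (rule has_bochner_integral_FTC_Icc) (auto intro!: derivative_eq_intros)
  then show ?thesis using True by simp
next
  case False
  define c where "c = 2 * pi * real_of_int m"
  have c: "c \<noteq> 0" using False by (simp add: c_def)
  have "has_bochner_integral lborel (\<lambda>t. indicator {0..1} t *\<^sub>R cis (c * t))
      (cis (c * 1) / (\<i> * of_real c) - cis (c * 0) / (\<i> * of_real c))"
  proof (rule has_bochner_integral_FTC_Icc)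
    fix x :: real
    have "((\<lambda>z. exp (\<i> * of_real c * z) / (\<i> * of_real c)) has_field_derivative exp (\<i> * of_real c * of_real x)) (at (of_real x))"
      using c by (auto intro!: derivative_eq_intros)
    then have "((\<lambda>t. exp (\<i> * of_real c * of_real t) / (\<i> * of_real c)) has_vector_derivative exp (\<i> * of_real c * of_real x)) (at x within {0..1})"
      by (rule has_vector_derivative_real_field)
    then show "((\<lambda>t. cis (c * t) / (\<i> * of_real c)) has_vector_derivative cis (c * x)) (at x within {0..1})"
      by (simp add: cis_conv_exp mult.assoc)
  qed (auto intro!: continuous_intros)
  moreover have "cis c = 1" unfolding c_def using cis_multiple_2pi[of "real_of_int m"] by simp
  ultimately show ?thesis using False by (simp add: c_def)
qed

lemma has_bochner_integral_cos:
  "has_bochner_integral lborel (\<lambda>t. indicator {0..1} t * cos (real_of_int m * (pi * t))) (if m = 0 then 1 else 0)"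
proof (cases "m = 0")
  case True
  have "has_bochner_integral lborel (\<lambda>t::real. indicator {0..1} t *\<^sub>R (1::real)) (1 - 0)"
    by (rule has_bochner_integral_FTC_Icc) (auto intro!: derivative_eq_intros)
  then show ?thesis using True by simp
next
  case False
  define c where "c = real_of_int m * pi"
  have c: "c \<noteq> 0" using False by (simp add: c_def)
  have "has_bochner_integral lborel (\<lambda>t. indicator {0..1} t *\<^sub>R cos (c * t)) (sin (c * 1) / c - sin (c * 0) / c)"
  proof (rule has_bochner_integral_FTC_Icc)
    fix x :: real
    show "((\<lambda>t. sin (c * t) / c) has_vector_derivative cos (c * x)) (at x within {0..1})"
      unfolding has_real_derivative_iff_has_vector_derivative[symmetric]
      using c by (auto intro!: derivative_eq_intros)
  qed (auto intro!: continuous_intros)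
  moreover have "sin c = 0" by (simp add: c_def sin_times_pi_eq_0)
  ultimately show ?thesis using False by (simp add: c_def mult.assoc)
qed

text \<open>The antiderivative is a multiple of \<open>sin (m arccos t)\<close>, or of \<open>arccos t\<close> for \<open>m = 0\<close>. Since the
  density is unbounded near the end points, the fundamental theorem is used for the gauge
  integral with derivatives in the interior only; the nonnegative case \<open>m = 0\<close> is then Lebesgue
  integrable and dominates the others.\<close>

lemma has_bochner_integral_chebyshev:
  "has_bochner_integral lborel (\<lambda>t. indicator {-1..1} t * (1 / (pi * sqrt (1 - t\<^sup>2))) * cos (real_of_int m * arccos t))
    (if m = 0 then 1 else 0)"
proof -
  define f where "f = (\<lambda>m t. 1 / (pi * sqrt (1 - t\<^sup>2)) * cos (real_of_int m * arccos t))"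
  have deriv: "(arccos has_real_derivative - (1 / sqrt (1 - x\<^sup>2))) (at x)" if "x \<in> {-1<..<1}" for x
    using DERIV_arccos[of x] that by (simp add: inverse_eq_divide)
  have HK: "(f m has_integral (if m = 0 then 1 else 0)) {-1..1}" for m
  proof (cases "m = 0")
    case True
    have "(f m has_integral (- (arccos 1 / pi) - - (arccos (-1) / pi))) {-1..1}"
    proof (rule fundamental_theorem_of_calculus_interior)
      fix x :: real assume x: "x \<in> {-1<..<1}"
      show "((\<lambda>x. - (arccos x / pi)) has_vector_derivative f m x) (at x)"
        unfolding has_real_derivative_iff_has_vector_derivative[symmetric]
        using DERIV_minus[OF DERIV_cdivide[OF deriv[OF x], of pi]] by (simp add: f_def True mult.commute)
    qed (auto intro!: continuous_intros)
    then show ?thesis using True by simp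
  next
    case False
    have "(f m has_integral (- (sin (real_of_int m * arccos 1) / (pi * real_of_int m))
        - - (sin (real_of_int m * arccos (-1)) / (pi * real_of_int m)))) {-1..1}"
    proof (rule fundamental_theorem_of_calculus_interior)
      fix x :: real assume x: "x \<in> {-1<..<1}"
      show "((\<lambda>x. - (sin (real_of_int m * arccos x) / (pi * real_of_int m))) has_vector_derivative f m x) (at x)"
        unfolding has_real_derivative_iff_has_vector_derivative[symmetric]
        using DERIV_minus[OF DERIV_cdivide[OF DERIV_chain2[OF DERIV_sin DERIV_cmult[OF deriv[OF x]]], of "real_of_int m" "pi * real_of_int m"]]
          False by (simp add: f_def mult.commute)
    qed (use False in \<open>auto intro!: continuous_intros\<close>)
    moreover have "sin (real_of_int m * pi) = 0" by (simp add: sin_times_pi_eq_0)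
    ultimately show ?thesis using False by simp
  qed
  have meas [measurable]: "(\<lambda>t. indicator {-1..1} t *\<^sub>R cos (real_of_int m * arccos t)) \<in> borel_measurable borel" for m
    by (rule borel_measurable_continuous_on_indicator) (auto intro!: continuous_intros)
  have f_eq: "indicator {-1..1} t *\<^sub>R f m t
      = (indicator {-1..1} t *\<^sub>R cos (real_of_int m * arccos t)) * (1 / (pi * sqrt (1 - t\<^sup>2)))" for m t
    by (simp add: f_def)
  have f_meas: "(\<lambda>t. indicator {-1..1} t *\<^sub>R f m t) \<in> borel_measurable borel" for m
    unfolding f_eq by measurable
  have "f 0 absolutely_integrable_on {-1..1}"
  proof (rule nonnegative_absolutely_integrable_1)
    show "f 0 integrable_on {-1..1}" using HK[of 0] by blast
  qed (auto simp: f_def abs_square_le_1)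
  then have int0: "integrable lborel (\<lambda>t. indicator {-1..1} t *\<^sub>R f 0 t)"
    unfolding set_integrable_def by (subst (asm) integrable_completion) (use f_meas[of 0] in simp_all)
  have "integrable lborel (\<lambda>t. indicator {-1..1} t *\<^sub>R f m t)"
  proof (rule Bochner_Integration.integrable_bound[OF int0])
    show "AE t in lborel. norm (indicator {-1..1} t *\<^sub>R f m t) \<le> norm (indicator {-1..1} t *\<^sub>R f 0 t)"
    proof (rule AE_I2)
      fix t :: real
      have "norm (indicator {-1..1} t *\<^sub>R f m t) = norm (indicator {-1..1} t *\<^sub>R f 0 t) * \<bar>cos (real_of_int m * arccos t)\<bar>"
        by (simp add: f_def abs_mult)
      then show "norm (indicator {-1..1} t *\<^sub>R f m t) \<le> norm (indicator {-1..1} t *\<^sub>R f 0 t)"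
        by (simp only: mult_left_le[OF abs_cos_le_one norm_ge_zero])
    qed
  qed (use f_meas[of m] in simp)
  then have set_int: "set_integrable lborel {-1..1} (f m)" unfolding set_integrable_def .
  have "(LINT t:{-1..1}|lborel. f m t) = (if m = 0 then 1 else 0)"
    using set_borel_integral_eq_integral(2)[OF set_int] integral_unique[OF HK[of m]] by simp
  then have "has_bochner_integral lborel (\<lambda>t. indicator {-1..1} t *\<^sub>R f m t) (if m = 0 then 1 else 0)"
    using set_int unfolding set_integrable_def set_lebesgue_integral_def
    by (simp only: has_bochner_integral_iff simp_thms)
  then show ?thesis by (simp add: f_def mult.assoc)
qed

text \<open>Product-to-sum reduces the scalar product of two cosines to the integrals of the cosines of
  frequencies \<open>k - l\<close> and \<open>k + l\<close>. Nonnegativity ensures that \<open>k + l\<close> vanishes only for \<open>k = l = 0\<close>.\<close>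

lemma factor_orthonormal:
  assumes "s \<noteq> Fourier \<Longrightarrow> 0 \<le> k \<and> 0 \<le> l"
  shows "has_bochner_integral lborel (\<lambda>t. weight s t *\<^sub>R (factor s k t * cnj (factor s l t))) (if k = l then 1 else 0)"
proof -
  have cosine_like: "has_bochner_integral lborel
      (\<lambda>t. w t *\<^sub>R (complex_of_real ((if k = 0 then 1 else sqrt 2) * cos (real_of_int k * \<theta> t))
          * cnj (complex_of_real ((if l = 0 then 1 else sqrt 2) * cos (real_of_int l * \<theta> t)))))
      (if k = l then 1 else 0)"
    if w: "\<And>m. has_bochner_integral lborel (\<lambda>t. w t * cos (real_of_int m * \<theta> t)) (if m = 0 then 1 else 0)"
      and kl: "0 \<le> k" "0 \<le> l" for w \<theta> :: "real \<Rightarrow> real"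
  proof -
    define c where "c = (if k = 0 then 1 else sqrt 2) * (if l = 0 then 1 else sqrt 2)"
    have "has_bochner_integral lborel
        (\<lambda>t. complex_of_real (c / 2 * (w t * cos (real_of_int (k - l) * \<theta> t) + w t * cos (real_of_int (k + l) * \<theta> t))))
        (complex_of_real (c / 2 * ((if k - l = 0 then 1 else 0) + (if k + l = 0 then 1 else 0))))"
      by (intro has_bochner_integral_of_real has_bochner_integral_mult_right has_bochner_integral_add w)
    moreover have "c / 2 * (w t * cos (real_of_int (k - l) * \<theta> t) + w t * cos (real_of_int (k + l) * \<theta> t))
        = w t * (((if k = 0 then 1 else sqrt 2) * cos (real_of_int k * \<theta> t)) * ((if l = 0 then 1 else sqrt 2) * cos (real_of_int l * \<theta> t)))" for t
    proof -
      have "cos (real_of_int (k - l) * \<theta> t) + cos (real_of_int (k + l) * \<theta> t)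
          = 2 * cos (real_of_int k * \<theta> t) * cos (real_of_int l * \<theta> t)"
        by (simp add: left_diff_distrib distrib_right cos_diff cos_add)
      then have "c / 2 * (w t * (cos (real_of_int (k - l) * \<theta> t) + cos (real_of_int (k + l) * \<theta> t)))
          = c * w t * cos (real_of_int k * \<theta> t) * cos (real_of_int l * \<theta> t)" by simp
      then show ?thesis by (simp only: distrib_left c_def mult_ac)
    qed
    moreover have "complex_of_real (c / 2 * ((if k - l = 0 then 1 else 0) + (if k + l = 0 then 1 else 0))) = (if k = l then 1 else 0)"
    proof -
      have "c / 2 * ((if k - l = 0 then 1 else 0) + (if k + l = 0 then 1 else 0)) = (if k = l then 1 else 0)"
        using kl by (auto simp: c_def)
      then show ?thesis by simp
    qed
    ultimately show ?thesis
      by (simp only: scaleR_conv_of_real complex_cnj_complex_of_real of_real_mult[symmetric])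
  qed
  show ?thesis
  proof (cases s)
    case Fourier
    have "cis (2 * pi * real_of_int k * t) * cnj (cis (2 * pi * real_of_int l * t)) = cis (2 * pi * real_of_int (k - l) * t)" for t
      by (simp add: cis_cnj cis_mult algebra_simps)
    then show ?thesis using has_bochner_integral_cis[of "k - l"] Fourier by simp
  next
    case (Cosine p)
    then show ?thesis
      using cosine_like[of "indicator {0..1}" "\<lambda>t. pi * t", OF has_bochner_integral_cos] assms by simp
  next
    case (Chebyshev p)
    then show ?thesis
      using cosine_like[of "\<lambda>t. indicator {-1..1} t * (1 / (pi * sqrt (1 - t\<^sup>2)))" arccos, OF has_bochner_integral_chebyshev] assms by simp
  qed
qed


lemma prod_indicator_cbox:
  fixes x :: "real^'d"
  shows "(\<Prod>j\<in>UNIV. indicator {a..b} (x $ j)) = (indicator (cbox (vec a) (vec b)) x :: real)"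
proof (cases "x \<in> cbox (vec a) (vec b)")
  case True
  then show ?thesis by (simp add: mem_box_cart)
next
  case False
  then obtain j where "x $ j \<notin> {a..b}" by (auto simp: mem_box_cart)
  then have "(\<Prod>j\<in>UNIV. indicator {a..b} (x $ j)) = (0 :: real)"
    by (intro prod_zero bexI[of _ j]) auto
  then show ?thesis using False by simp
qed

lemma sets_mu: "sets (mu s) = sets (restrict_space borel (domain_of s))"
  by (cases s) (simp_all add: sets_restrict_space)

lemma space_mu [simp]: "space (mu s) = domain_of s"
  by (cases s) (simp_all add: space_restrict_space)

lemma borel_measurable_mu_continuous:
  fixes h :: "real^'d \<Rightarrow> 'b::topological_space"
  assumes "continuous_on (domain_of s) h"
  shows "h \<in> borel_measurable (mu s)"
  using borel_measurable_continuous_on_restrict[OF assms]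
  by (simp only: measurable_cong_sets[OF sets_mu refl])

text \<open>The density in the definition of \<open>mu\<close>, named so that its properties can be stated.\<close>

definition chebyshev_density :: "real^'d \<Rightarrow> real" where
  "chebyshev_density x = 1 / (\<Prod>j\<in>UNIV. pi * sqrt (1 - (x $ j)\<^sup>2))"

lemma borel_measurable_chebyshev_density [measurable]:
  "chebyshev_density \<in> borel_measurable (restrict_space lborel D)"
proof (rule measurable_restrict_space1)
  show "(chebyshev_density :: real^'d \<Rightarrow> real) \<in> borel_measurable lborel"
    unfolding chebyshev_density_def by measurable
qed

lemma chebyshev_density_nonneg:
  assumes "x \<in> cbox (vec (-1)) (vec 1)"
  shows "0 \<le> chebyshev_density x"
proof -
  have "\<bar>x $ j\<bar> \<le> 1" for j using assms by (auto simp: mem_box_cart abs_le_iff minus_le_iff)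
  then have "(x $ j)\<^sup>2 \<le> 1" for j by (simp add: abs_square_le_1)
  then show ?thesis unfolding chebyshev_density_def by (intro divide_nonneg_nonneg prod_nonneg) auto
qed

lemma chebyshev_density_pos:
  assumes "x \<in> box (vec (-1)) (vec 1)"
  shows "0 < chebyshev_density x"
proof -
  have "\<bar>x $ j\<bar> < 1" for j using assms by (auto simp: mem_box_cart abs_less_iff minus_less_iff)
  then have "(x $ j)\<^sup>2 < 1" for j by (simp add: abs_square_less_1)
  then show ?thesis unfolding chebyshev_density_def by (intro divide_pos_pos prod_pos) auto
qed

lemma mu_Chebyshev:
  "mu (Chebyshev p) = density (restrict_space lborel (cbox (vec (-1)) (vec 1))) (\<lambda>x. ennreal (chebyshev_density x))"
  by (simp add: chebyshev_density_def)

lemma integral_mu_eq: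
  fixes h :: "real^'d \<Rightarrow> 'b::{banach, second_countable_topology}"
  assumes h: "h \<in> borel_measurable (mu s)"
  shows "integral\<^sup>L (mu s) h = (LINT x|lborel. (\<Prod>j\<in>UNIV. weight s (x $ j)) *\<^sub>R h x)"
proof (cases s)
  case (Chebyshev p)
  let ?D = "cbox (vec (-1)) (vec 1) :: (real^'d) set"
  have w: "(\<Prod>j\<in>UNIV. weight s (x $ j)) = indicator ?D x * chebyshev_density x" for x
    unfolding Chebyshev weight.simps prod.distrib prod_indicator_cbox by (simp add: chebyshev_density_def prod_dividef)
  have hm: "h \<in> borel_measurable (restrict_space lborel ?D)"
    using h by (simp add: Chebyshev)
  have nn: "AE x in restrict_space lborel ?D. 0 \<le> chebyshev_density x"
    by (rule AE_I2) (simp add: space_restrict_space chebyshev_density_nonneg)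
  show ?thesis
    unfolding Chebyshev mu_Chebyshev integral_density[OF hm borel_measurable_chebyshev_density nn] w[unfolded Chebyshev]
    by (simp add: integral_restrict_space)
qed (simp_all add: integral_restrict_space prod_indicator_cbox)

lemma continuous_on_alpha [continuous_intros]: "continuous_on (domain_of s) (alpha s k)"
proof (cases s)
  case Fourier
  show ?thesis unfolding Fourier by (auto simp: rdot_def intro!: continuous_intros)
next
  case (Cosine p)
  show ?thesis unfolding Cosine by (auto intro!: continuous_intros)
next
  case (Chebyshev p)
  show ?thesis unfolding Chebyshev
    by (auto simp: mem_box_cart intro!: continuous_intros)
qed

lemma integral_alpha_product:
  assumes "k \<in> index_domain s" "l \<in> index_domain s"
  shows "(LINT x|mu s. alpha s k x * cnj (alpha s l x)) = (if k = l then 1 else 0)"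
proof -
  let ?f = "\<lambda>j t. weight s t *\<^sub>R (factor s (k $ j) t * cnj (factor s (l $ j) t))"
  have "s \<noteq> Fourier \<Longrightarrow> 0 \<le> k $ j \<and> 0 \<le> l $ j" for j
    using assms by (cases s) (auto simp: nonneg_indices_def)
  then have f: "has_bochner_integral lborel (?f j) (if k $ j = l $ j then 1 else 0)" for j
    by (rule factor_orthonormal)
  then have int: "integrable lborel (?f j)" for j unfolding has_bochner_integral_iff by blast
  have eq: "(\<Prod>j\<in>UNIV. weight s (x $ j)) *\<^sub>R (alpha s k x * cnj (alpha s l x)) = (\<Prod>j\<in>UNIV. ?f j (x $ j))" for x
    by (simp add: alpha_eq_prod scaleR_conv_of_real prod.distrib)
  have meas: "(\<lambda>x. alpha s k x * cnj (alpha s l x)) \<in> borel_measurable (mu s)"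
    by (intro borel_measurable_mu_continuous continuous_intros)
  have "(LINT x|mu s. alpha s k x * cnj (alpha s l x)) = (\<Prod>j\<in>UNIV. if k $ j = l $ j then 1 else 0)"
    unfolding integral_mu_eq[OF meas] eq integral_prod_vec[OF int]
    by (simp only: has_bochner_integral_integral_eq[OF f])
  also have "\<dots> = (if k = l then 1 else 0)"
    by (auto simp: vec_eq_iff intro!: prod_zero)
  finally show "(LINT x|mu s. alpha s k x * cnj (alpha s l x)) = (if k = l then 1 else 0)" .
qed

lemma alpha_zero [simp]: "alpha s 0 x = 1"
  by (cases s) (simp_all add: rdot_def)

text \<open>The total mass is the scalar product of the constant function \<open>\<alpha>\<^sub>0 = 1\<close> with itself.\<close>

lemma
  shows measure_mu: "measure (mu s :: (real^'d) measure) (domain_of s) = 1"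
    and finite_measure_mu: "finite_measure (mu s :: (real^'d) measure)"
proof -
  let ?M = "mu s :: (real^'d) measure"
  have 0: "(0 :: int^'d) \<in> index_domain s" by (cases s) (auto simp: nonneg_indices_def)
  have "(LINT x|?M. 1 :: complex) = 1"
    using integral_alpha_product[OF 0 0] by simp
  then have m: "measure ?M (space ?M) = 1"
    by (simp only: lebesgue_integral_const scaleR_conv_of_real mult_1_right of_real_eq_1_iff)
  show "finite_measure ?M"
  proof (rule finite_measureI, rule notI)
    assume "emeasure ?M (space ?M) = \<infinity>"
    then have "measure ?M (space ?M) = 0" by (simp add: measure_def)
    then show False using m by simp
  qed
  show "measure ?M (domain_of s) = 1" using m by simp
qed


section \<open>Continuous functions on the domain\<close>

lemma AE_mu_interior:
  assumes "AE x in mu s. P x"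
  shows "AE x in lborel. x \<in> interior (domain_of s) \<longrightarrow> P x"
proof (cases s)
  case (Chebyshev p)
  have "AE x in restrict_space lborel (cbox (vec (-1)) (vec 1)). 0 < chebyshev_density x \<longrightarrow> P x"
    using assms unfolding Chebyshev mu_Chebyshev by (simp add: AE_density)
  then have "AE x in lborel. x \<in> cbox (vec (-1)) (vec 1) \<longrightarrow> 0 < chebyshev_density x \<longrightarrow> P x"
    by (simp add: AE_restrict_space_iff)
  then show ?thesis unfolding Chebyshev domain_of.simps interior_cbox
    by (rule eventually_mono) (use chebyshev_density_pos box_subset_cbox in blast)
next
  case Fourier
  have "AE x in lborel. x \<in> domain_of s \<longrightarrow> P x" using assms unfolding Fourier mu.simps(1)
    by (subst (asm) AE_restrict_space_iff) auto
  then show ?thesis by (rule eventually_mono) (use interior_subset in blast)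
next
  case (Cosine p)
  have "AE x in lborel. x \<in> domain_of s \<longrightarrow> P x" using assms unfolding Cosine mu.simps(2)
    by (subst (asm) AE_restrict_space_iff) auto
  then show ?thesis by (rule eventually_mono) (use interior_subset in blast)
qed

lemma emeasure_lborel_open_pos:
  fixes U :: "'a::euclidean_space set"
  assumes "open U" "U \<noteq> {}"
  shows "emeasure lborel U > 0"
proof -
  obtain x where "x \<in> U" using assms(2) by blast
  from open_contains_box[OF assms(1) this]
  obtain a b where ab: "box a b \<subseteq> U" "\<forall>i\<in>Basis. a \<bullet> i < b \<bullet> i" by metis
  then have "0 < emeasure lborel (box a b)"
    using ab(2)
    by (auto simp: emeasure_lborel_box_eq less_imp_le inner_diff_left intro!: prod_pos)
  also have "\<dots> \<le> emeasure lborel U" using ab(1) assms(1) by (intro emeasure_mono) auto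
  finally show ?thesis .
qed

text \<open>The exceptional set is open in the interior and null, hence empty; the bound extends to the
  boundary because the domain is the closure of its interior.\<close>

lemma continuous_le_of_AE:
  assumes g: "continuous_on (domain_of s) g" and AE: "AE x in mu s. g x \<le> (c::real)" and x: "x \<in> domain_of s"
  shows "g x \<le> c"
proof -
  let ?I = "interior (domain_of s)"
  have closure: "closure ?I = domain_of s"
    by (cases s) (simp_all only: domain_of.simps interior_cbox, (rule closure_box, simp add: interval_ne_empty_cart)+)
  define U where "U = {x \<in> ?I. g x > c}"
  have "U = {}"
  proof (rule ccontr)
    assume "U \<noteq> {}"
    moreover have "open U"
    proof -
      have "continuous_on ?I g" using g interior_subset continuous_on_subset by blast
      then show ?thesis unfolding U_def
        by (intro continuous_open_preimage[of ?I g "{c<..}", unfolded vimage_def Int_def, simplified]) auto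
    qed
    ultimately have "emeasure lborel U > 0" by (rule emeasure_lborel_open_pos[rotated])
    moreover have "AE x in lborel. x \<notin> U"
      using AE_mu_interior[OF AE] by (rule eventually_mono) (auto simp: U_def)
    then have "emeasure lborel U = 0"
      using \<open>open U\<close> by (subst (asm) AE_iff_measurable[of U]) auto
    ultimately show False by simp
  qed
  then have "\<forall>x\<in>?I. g x \<le> c" by (force simp: U_def)
  then show ?thesis by (intro continuous_le_on_closure[of ?I g, unfolded closure, OF g x]) blast
qed


lemma norm_alpha_le: "norm (alpha s k x) \<le> sqrt 2 ^ CARD('d)" for k :: "int^'d"
proof -
  have "norm (factor s m t) \<le> sqrt 2" for m t
  proof -
    have c: "\<bar>cos y\<bar> \<le> sqrt 2" for y :: real
      using abs_cos_le_one[of y] real_sqrt_ge_one[of 2] by linarith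
    have "sqrt 2 * \<bar>cos y\<bar> \<le> sqrt 2" for y :: real
      by (rule mult_left_le) auto
    then show ?thesis using c real_sqrt_ge_one[of 2]
      by (cases s) (auto simp: norm_mult)
  qed
  then have "(\<Prod>j\<in>UNIV. norm (factor s (k $ j) (x $ j))) \<le> (\<Prod>j\<in>(UNIV :: 'd set). sqrt 2)"
    by (intro prod_mono) auto
  then show ?thesis by (simp add: alpha_eq_prod prod_norm)
qed

text \<open>All basis functions are bounded by the same constant, so absolute summability of the
  coefficients makes the series converge uniformly.\<close>

lemma function_space_continuous:
  fixes f :: "real^'d \<Rightarrow> complex"
  assumes "f \<in> function_space s"
  shows "continuous_on (domain_of s) f"
proof -
  have summ: "(\<lambda>k. norm (coef s f k)) summable_on index_domain s"
    and series: "\<And>x. x \<in> domain_of s \<Longrightarrow> ((\<lambda>k. coef s f k * alpha s k x) has_sum f x) (index_domain s)"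
    using assms by (auto simp: function_space_def)
  have lim: "uniform_limit (domain_of s) (\<lambda>K x. \<Sum>k\<in>K. coef s f k * alpha s k x) f
      (finite_subsets_at_top (index_domain s))"
  proof (rule Weierstrass_m_test_general')
    show "norm (coef s f k * alpha s k x) \<le> norm (coef s f k) * sqrt 2 ^ CARD('d)" for k x
      unfolding norm_mult by (intro mult_left_mono norm_alpha_le) simp
    show "(\<lambda>k. norm (coef s f k) * sqrt 2 ^ CARD('d)) summable_on index_domain s"
      by (rule summable_on_cmult_left[OF summ])
  qed (rule series)
  have cont: "\<forall>\<^sub>F K in finite_subsets_at_top (index_domain s).
      continuous_on (domain_of s) (\<lambda>x. \<Sum>k\<in>K. coef s f k * alpha s k x)"
    by (intro always_eventually allI continuous_intros)
  show ?thesis by (rule uniform_limit_theorem[OF cont lim]) simp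
qed

lemma integrable_mu_continuous:
  fixes h :: "real^'d \<Rightarrow> 'b::{banach, second_countable_topology}"
  assumes h: "continuous_on (domain_of s) h"
  shows "integrable (mu s) h"
proof -
  interpret finite_measure "mu s" by (rule finite_measure_mu)
  have "compact (domain_of s)" by (cases s) auto
  then have "bounded (h ` domain_of s)" using h compact_continuous_image compact_imp_bounded by blast
  then obtain B where "\<And>x. x \<in> domain_of s \<Longrightarrow> norm (h x) \<le> B" by (auto simp: bounded_iff)
  then show ?thesis
    by (intro integrable_const_bound[of h B] AE_I2 borel_measurable_mu_continuous h) simp
qed


section \<open>Expansions in orthogonal families\<close>

text \<open>Stated for an arbitrary measure because it is used twice: for \<open>\<mu>\<close>, where it splits the error
  of the approximation, and for the counting measure on the sample points.\<close>

lemma integral_norm_square_diff_sum: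
  fixes g :: "'a \<Rightarrow> complex" and e :: "'k \<Rightarrow> 'a \<Rightarrow> complex"
  assumes "finite K"
    and g: "integrable M (\<lambda>x. (norm (g x))\<^sup>2)"
    and ge: "\<And>k. k \<in> K \<Longrightarrow> integrable M (\<lambda>x. g x * cnj (e k x))"
    and ee: "\<And>k l. k \<in> K \<Longrightarrow> l \<in> K \<Longrightarrow> integrable M (\<lambda>x. e k x * cnj (e l x))"
    and orth: "\<And>k l. k \<in> K \<Longrightarrow> l \<in> K \<Longrightarrow> (LINT x|M. e k x * cnj (e l x)) = (if k = l then of_real (d k) else 0)"
  shows "(LINT x|M. (norm (g x - (\<Sum>k\<in>K. a k * e k x)))\<^sup>2)
    = (LINT x|M. (norm (g x))\<^sup>2) - 2 * Re (\<Sum>k\<in>K. cnj (a k) * (LINT x|M. g x * cnj (e k x)))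
      + (\<Sum>k\<in>K. (norm (a k))\<^sup>2 * d k)"
proof -
  define G where "G = (\<lambda>x. \<Sum>k\<in>K. cnj (a k) * (g x * cnj (e k x)))"
  define E where "E = (\<lambda>x. \<Sum>k\<in>K. \<Sum>l\<in>K. a k * cnj (a l) * (e k x * cnj (e l x)))"
  have square: "(norm (u - v))\<^sup>2 = (norm u)\<^sup>2 - 2 * Re (u * cnj v) + Re (v * cnj v)" for u v :: complex
    unfolding cmod_power2 by (simp add: power2_eq_square algebra_simps)
  have pointwise: "(norm (g x - (\<Sum>k\<in>K. a k * e k x)))\<^sup>2 = (norm (g x))\<^sup>2 - 2 * Re (G x) + Re (E x)" for x
  proof -
    have "g x * cnj (\<Sum>k\<in>K. a k * e k x) = G x"
      by (simp add: G_def cnj_sum sum_distrib_left mult.left_commute)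
    moreover have "(\<Sum>k\<in>K. a k * e k x) * cnj (\<Sum>k\<in>K. a k * e k x) = E x"
      by (simp add: E_def cnj_sum sum_product mult_ac)
    ultimately show ?thesis by (simp only: square)
  qed
  have G: "integrable M G" unfolding G_def
    by (intro Bochner_Integration.integrable_sum integrable_mult_right ge)
  have E: "integrable M E" unfolding E_def
    by (intro Bochner_Integration.integrable_sum integrable_mult_right ee)
  have LG: "integral\<^sup>L M G = (\<Sum>k\<in>K. cnj (a k) * (LINT x|M. g x * cnj (e k x)))"
    unfolding G_def by (subst Bochner_Integration.integral_sum) (auto intro: ge)
  have "integral\<^sup>L M E = (\<Sum>k\<in>K. \<Sum>l\<in>K. a k * cnj (a l) * (LINT x|M. e k x * cnj (e l x)))"
    unfolding E_def
    by (subst Bochner_Integration.integral_sum, (intro Bochner_Integration.integrable_sum integrable_mult_right ee; assumption),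
        intro sum.cong refl, subst Bochner_Integration.integral_sum) (auto intro: ee)
  also have "\<dots> = (\<Sum>k\<in>K. \<Sum>l\<in>K. if k = l then a k * cnj (a k) * of_real (d k) else 0)"
    by (intro sum.cong refl) (simp add: orth)
  also have "\<dots> = (\<Sum>k\<in>K. of_real ((norm (a k))\<^sup>2 * d k))"
    using \<open>finite K\<close> by (intro sum.cong refl) (simp add: complex_norm_square[symmetric])
  finally have LE: "Re (integral\<^sup>L M E) = (\<Sum>k\<in>K. (norm (a k))\<^sup>2 * d k)" by simp
  have "(LINT x|M. (norm (g x - (\<Sum>k\<in>K. a k * e k x)))\<^sup>2)
      = (LINT x|M. (norm (g x))\<^sup>2) - (LINT x|M. 2 * Re (G x)) + (LINT x|M. Re (E x))"
    unfolding pointwise using g G E by simp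
  then show ?thesis using G E LG LE by simp
qed

lemma bessel_inequality:
  fixes g :: "'a \<Rightarrow> complex" and e :: "'k \<Rightarrow> 'a \<Rightarrow> complex"
  assumes "finite K"
    and g: "integrable M (\<lambda>x. (norm (g x))\<^sup>2)"
    and ge: "\<And>k. k \<in> K \<Longrightarrow> integrable M (\<lambda>x. g x * cnj (e k x))"
    and ee: "\<And>k l. k \<in> K \<Longrightarrow> l \<in> K \<Longrightarrow> integrable M (\<lambda>x. e k x * cnj (e l x))"
    and orth: "\<And>k l. k \<in> K \<Longrightarrow> l \<in> K \<Longrightarrow> (LINT x|M. e k x * cnj (e l x)) = (if k = l then of_real (d k) else 0)"
    and d: "\<And>k. k \<in> K \<Longrightarrow> d k > 0"
  shows "(\<Sum>k\<in>K. (norm (LINT x|M. g x * cnj (e k x)))\<^sup>2 / d k) \<le> (LINT x|M. (norm (g x))\<^sup>2)"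
proof -
  define q where "q = (\<lambda>k. LINT x|M. g x * cnj (e k x))"
  \<comment> \<open>the coefficients \<open>q k / d k\<close> minimise the distance of \<open>g\<close> to the span of the family\<close>
  have "Re (\<Sum>k\<in>K. cnj (q k / of_real (d k)) * q k) = (\<Sum>k\<in>K. (norm (q k))\<^sup>2 / d k)"
    unfolding Re_sum
  proof (intro sum.cong refl)
    fix k
    have "cnj (q k / of_real (d k)) * q k = of_real ((norm (q k))\<^sup>2 / d k)"
      using complex_norm_square[of "q k"] by (simp add: mult.commute)
    then show "Re (cnj (q k / of_real (d k)) * q k) = (norm (q k))\<^sup>2 / d k" by (simp only: Re_complex_of_real)
  qed
  moreover have "(\<Sum>k\<in>K. (norm (q k / of_real (d k)))\<^sup>2 * d k) = (\<Sum>k\<in>K. (norm (q k))\<^sup>2 / d k)"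
    by (intro sum.cong refl) (use d in \<open>auto simp: norm_divide power2_eq_square\<close>)
  moreover have "0 \<le> (LINT x|M. (norm (g x - (\<Sum>k\<in>K. q k / of_real (d k) * e k x)))\<^sup>2)"
    by (rule Bochner_Integration.integral_nonneg) simp
  ultimately show ?thesis
    using integral_norm_square_diff_sum[OF assms(1-5), of "\<lambda>k. q k / of_real (d k)"]
    unfolding q_def by linarith
qed


section \<open>Error of the lattice approximation\<close>

lemma lattice_rule_eq_integral:
  assumes "n \<ge> 1"
  shows "lattice_rule n z h = (LINT i|uniform_count_measure {..<n}. h (lattice_point n z i))"
  by (simp add: lattice_rule_def uniform_count_measure_def lebesgue_integral_point_measure_finite
      scaleR_conv_of_real sum_divide_distrib)

lemma integrable_uniform_count_measure:
  "finite A \<Longrightarrow> integrable (uniform_count_measure A) h" for h :: "'a \<Rightarrow> 'b::{banach, second_countable_topology}"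
  by (simp add: uniform_count_measure_def integrable_point_measure_finite)

lemma lattice_rule_add: "lattice_rule n z (\<lambda>x. g x + h x) = lattice_rule n z g + lattice_rule n z h"
  by (simp add: lattice_rule_def sum.distrib add_divide_distrib)

lemma lattice_rule_sum_mult:
  "lattice_rule n z (\<lambda>x. \<Sum>k\<in>K. c k * h k x) = (\<Sum>k\<in>K. c k * lattice_rule n z (h k))"
proof -
  have "(\<Sum>i<n. \<Sum>k\<in>K. c k * h k (lattice_point n z i)) = (\<Sum>k\<in>K. c k * (\<Sum>i<n. h k (lattice_point n z i)))"
    unfolding sum_distrib_left by (rule sum.swap)
  then show ?thesis by (simp only: lattice_rule_def sum_divide_distrib[of _ K] times_divide_eq_right)
qed

lemma phi_in_domain:
  assumes "x \<in> cbox (vec 0) (vec 1)"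
  shows "phi s x \<in> domain_of s"
proof -
  have "0 \<le> x $ j \<and> x $ j \<le> 1" for j using assms by (simp add: mem_box_cart)
  then have "0 \<le> tent (x $ j) \<and> tent (x $ j) \<le> 1" for j using tent_bounds by blast
  then show ?thesis using assms by (cases s) (auto simp: mem_box_cart)
qed

lemma d_const_pos: "d_const p k > 0"
  by (simp add: d_const_def)

lemma rho_nonneg:
  assumes "finite \<Lambda>" "\<Lambda> \<noteq> {}"
  shows "0 \<le> rho p n z \<Lambda>"
proof -
  obtain k where "k \<in> \<Lambda>" using assms(2) by blast
  then have "real (d_const p k) / (real (c_const p n z k))\<^sup>2 \<le> rho p n z \<Lambda>"
    unfolding rho_def using assms(1) by (intro Max_ge) auto
  moreover have "0 \<le> real (d_const p k) / (real (c_const p n z k))\<^sup>2" by simp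
  ultimately show ?thesis by linarith
qed

context
  fixes s :: setting and \<Lambda> :: "(int^'d) set" and f :: "real^'d \<Rightarrow> complex" and n :: nat and z :: "int^'d"
  assumes fin: "finite \<Lambda>" and ne: "\<Lambda> \<noteq> {}" and sub: "\<Lambda> \<subseteq> index_domain s"
    and f: "f \<in> function_space s" and n: "n \<ge> 1" and adm: "admissible s n \<Lambda> z"
begin

definition remainder :: "real^'d \<Rightarrow> complex" where
  "remainder x = f x - truncation s \<Lambda> f x"

definition aliasing :: "int^'d \<Rightarrow> complex" where
  "aliasing k = lattice_rule n z (\<lambda>x. remainder (phi s x) * cnj (v_fun s k x))"

lemma continuous_remainder: "continuous_on (domain_of s) remainder"
  unfolding remainder_def truncation_def
  by (intro continuous_intros function_space_continuous[OF f])

lemma integral_remainder_alpha: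
  assumes k: "k \<in> \<Lambda>"
  shows "(LINT x|mu s. remainder x * cnj (alpha s k x)) = 0"
proof -
  have kd: "k \<in> index_domain s" using k sub by blast
  have int_f: "integrable (mu s) (\<lambda>x. f x * cnj (alpha s k x))"
    by (intro integrable_mu_continuous continuous_intros function_space_continuous[OF f])
  have int_a: "integrable (mu s) (\<lambda>x. coef s f l * (alpha s l x * cnj (alpha s k x)))" for l
    by (intro integrable_mu_continuous continuous_intros)
  have "(LINT x|mu s. remainder x * cnj (alpha s k x))
      = (LINT x|mu s. f x * cnj (alpha s k x) - (\<Sum>l\<in>\<Lambda>. coef s f l * (alpha s l x * cnj (alpha s k x))))"
    by (simp add: remainder_def truncation_def left_diff_distrib sum_distrib_right mult.assoc)
  also have "\<dots> = coef s f k - (\<Sum>l\<in>\<Lambda>. coef s f l * (LINT x|mu s. alpha s l x * cnj (alpha s k x)))"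
    using int_f int_a by (simp add: coef_def[of s f k])
  also have "(\<Sum>l\<in>\<Lambda>. coef s f l * (LINT x|mu s. alpha s l x * cnj (alpha s k x)))
      = (\<Sum>l\<in>\<Lambda>. if l = k then coef s f l else 0)"
    by (intro sum.cong refl) (use integral_alpha_product[OF _ kd] sub in auto)
  also have "\<dots> = coef s f k" using fin k by simp
  finally show ?thesis by simp
qed

text \<open>The sampled coefficients reproduce functions spanned by the basis functions with indices in
  \<open>\<Lambda>\<close>, so only the samples of the remainder contribute to the coefficient error.\<close>

lemma lattice_coef_minus_coef:
  assumes k: "k \<in> \<Lambda>"
  shows "lattice_coef s n z f k - coef s f k = aliasing k / of_nat (c_const (plan_of s) n z k)"
proof -
  let ?c = "of_nat (c_const (plan_of s) n z k) :: complex"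
  have "?c \<noteq> 0" using c_const_pos[of "plan_of s" n z k] by simp
  have "f (phi s x) * cnj (v_fun s k x)
      = remainder (phi s x) * cnj (v_fun s k x) + (\<Sum>l\<in>\<Lambda>. coef s f l * (u_fun s l x * cnj (v_fun s k x)))" for x
    by (simp add: remainder_def truncation_def u_fun_def left_diff_distrib sum_distrib_right mult.assoc)
  then have "lattice_rule n z (\<lambda>x. f (phi s x) * cnj (v_fun s k x))
      = aliasing k + (\<Sum>l\<in>\<Lambda>. coef s f l * lattice_rule n z (\<lambda>x. u_fun s l x * cnj (v_fun s k x)))"
    by (simp only: lattice_rule_add lattice_rule_sum_mult aliasing_def)
  also have "(\<Sum>l\<in>\<Lambda>. coef s f l * lattice_rule n z (\<lambda>x. u_fun s l x * cnj (v_fun s k x)))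
      = (\<Sum>l\<in>\<Lambda>. if l = k then coef s f l * ?c else 0)"
    by (intro sum.cong refl) (use adm k in \<open>auto simp: admissible_def\<close>)
  also have "\<dots> = coef s f k * ?c" using fin k by simp
  finally show ?thesis using \<open>?c \<noteq> 0\<close> by (simp add: lattice_coef_def add_divide_distrib)
qed

text \<open>Bessel's inequality for the functions \<open>v\<^sub>k\<close> sampled at the lattice points.\<close>

lemma sum_aliasing_le:
  "(\<Sum>k\<in>\<Lambda>. (norm (aliasing k))\<^sup>2 / real (d_const (plan_of s) k)) \<le> (sampling_seminorm s n z remainder)\<^sup>2"
proof -
  let ?M = "uniform_count_measure {..<n}"
  let ?t = "lattice_point n z"
  have "(\<Sum>k\<in>\<Lambda>. (norm (LINT i|?M. remainder (phi s (?t i)) * cnj (v_fun s k (?t i))))\<^sup>2 / real (d_const (plan_of s) k))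
      \<le> (LINT i|?M. (norm (remainder (phi s (?t i))))\<^sup>2)"
  proof (rule bessel_inequality[OF fin])
    fix k l assume "k \<in> \<Lambda>" "l \<in> \<Lambda>"
    then show "(LINT i|?M. v_fun s k (?t i) * cnj (v_fun s l (?t i)))
        = (if k = l then of_real (real (d_const (plan_of s) k)) else 0)"
      using adm by (simp add: admissible_def lattice_rule_eq_integral[OF n])
  qed (simp_all add: integrable_uniform_count_measure d_const_pos)
  moreover have "(LINT i|?M. (norm (remainder (phi s (?t i))))\<^sup>2) = (sampling_seminorm s n z remainder)\<^sup>2"
    by (simp add: sampling_seminorm_def integral_uniform_count_measure sum_nonneg)
  ultimately show ?thesis by (simp add: aliasing_def lattice_rule_eq_integral[OF n])
qed

text \<open>The squared error is the squared norm of the remainder plus the sum of the squared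
  coefficient errors; the mixed terms vanish by \<open>integral_remainder_alpha\<close>.\<close>

lemma L2_error_le:
  "(L2_norm (mu s) (\<lambda>x. f x - lattice_approx s n z \<Lambda> f x))\<^sup>2
    \<le> (L2_norm (mu s) remainder)\<^sup>2 + rho (plan_of s) n z \<Lambda> * (sampling_seminorm s n z remainder)\<^sup>2"
proof -
  let ?c = "\<lambda>k. real (c_const (plan_of s) n z k)" and ?d = "\<lambda>k. real (d_const (plan_of s) k)"
  let ?a = "\<lambda>k. aliasing k / of_real (?c k)"
  have error: "f x - lattice_approx s n z \<Lambda> f x = remainder x - (\<Sum>k\<in>\<Lambda>. ?a k * alpha s k x)" for x
  proof -
    have "(\<Sum>k\<in>\<Lambda>. ?a k * alpha s k x) = (\<Sum>k\<in>\<Lambda>. (lattice_coef s n z f k - coef s f k) * alpha s k x)"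
      by (intro sum.cong refl) (simp add: lattice_coef_minus_coef)
    then show ?thesis
      by (simp add: remainder_def lattice_approx_def truncation_def left_diff_distrib sum_subtractf)
  qed
  have "(LINT x|mu s. (norm (remainder x - (\<Sum>k\<in>\<Lambda>. ?a k * alpha s k x)))\<^sup>2)
    = (LINT x|mu s. (norm (remainder x))\<^sup>2)
      - 2 * Re (\<Sum>k\<in>\<Lambda>. cnj (?a k) * (LINT x|mu s. remainder x * cnj (alpha s k x)))
      + (\<Sum>k\<in>\<Lambda>. (norm (?a k))\<^sup>2 * 1)"
  proof (rule integral_norm_square_diff_sum[OF fin])
    show "integrable (mu s) (\<lambda>x. (norm (remainder x))\<^sup>2)"
      by (intro integrable_mu_continuous continuous_intros continuous_remainder)
    show "integrable (mu s) (\<lambda>x. remainder x * cnj (alpha s k x))" for k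
      by (intro integrable_mu_continuous continuous_intros continuous_remainder)
    show "integrable (mu s) (\<lambda>x. alpha s k x * cnj (alpha s l x))" for k l
      by (intro integrable_mu_continuous continuous_intros)
    show "(LINT x|mu s. alpha s k x * cnj (alpha s l x)) = (if k = l then of_real 1 else 0)"
      if "k \<in> \<Lambda>" "l \<in> \<Lambda>" for k l
      using integral_alpha_product[of k s l] subsetD[OF sub that(1)] subsetD[OF sub that(2)] by simp
  qed
  also have "\<dots> = (LINT x|mu s. (norm (remainder x))\<^sup>2) + (\<Sum>k\<in>\<Lambda>. (norm (?a k))\<^sup>2)"
    by (simp add: integral_remainder_alpha)
  also have "(\<Sum>k\<in>\<Lambda>. (norm (?a k))\<^sup>2) \<le> rho (plan_of s) n z \<Lambda> * (\<Sum>k\<in>\<Lambda>. (norm (aliasing k))\<^sup>2 / ?d k)"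
    unfolding sum_distrib_left
  proof (rule sum_mono)
    fix k assume k: "k \<in> \<Lambda>"
    have "(norm (?a k))\<^sup>2 = ?d k / (?c k)\<^sup>2 * ((norm (aliasing k))\<^sup>2 / ?d k)"
      using d_const_pos[of "plan_of s" k] by (simp add: norm_divide power_divide)
    also have "\<dots> \<le> rho (plan_of s) n z \<Lambda> * ((norm (aliasing k))\<^sup>2 / ?d k)"
      unfolding rho_def using fin k by (intro mult_right_mono Max_ge) auto
    finally show "(norm (?a k))\<^sup>2 \<le> rho (plan_of s) n z \<Lambda> * ((norm (aliasing k))\<^sup>2 / ?d k)" .
  qed
  also have "\<dots> \<le> rho (plan_of s) n z \<Lambda> * (sampling_seminorm s n z remainder)\<^sup>2"
    by (intro mult_left_mono sum_aliasing_le rho_nonneg fin ne)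
  finally show ?thesis
    unfolding L2_norm_def error by (simp add: Bochner_Integration.integral_nonneg)
qed

text \<open>The sampling points lie in the domain, where the remainder is bounded pointwise by its
  essential supremum; this also excludes the value \<open>-\<infinity>\<close> of the latter.\<close>

lemma L2_error_le_Linf:
  "ereal (L2_norm (mu s) (\<lambda>x. f x - lattice_approx s n z \<Lambda> f x))
    \<le> ereal (sqrt (1 + rho (plan_of s) n z \<Lambda>)) * Linf_norm (mu s) remainder"
proof -
  let ?\<rho> = "rho (plan_of s) n z \<Lambda>"
  have \<rho>: "?\<rho> \<ge> 0" by (rule rho_nonneg[OF fin ne])
  have AE: "AE x in mu s. ereal (norm (remainder x)) \<le> Linf_norm (mu s) remainder"
    unfolding Linf_norm_def by (rule esssup_AE)
  have cont: "continuous_on (domain_of s) (\<lambda>x. norm (remainder x))"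
    by (intro continuous_intros continuous_remainder)
  have sup: "norm (remainder x) \<le> c" if "Linf_norm (mu s) remainder \<le> ereal c" "x \<in> domain_of s" for c x
  proof (rule continuous_le_of_AE[OF cont _ that(2)])
    show "AE x in mu s. norm (remainder x) \<le> c"
      using AE by (rule eventually_mono) (use that(1) order_trans in fastforce)
  qed
  have point: "phi s (lattice_point n z i) \<in> domain_of s" for i
    by (rule phi_in_domain[OF lattice_point_in_box[OF n]])
  show ?thesis
  proof (cases "Linf_norm (mu s) remainder")
    case (real c)
    have le: "norm (remainder x) \<le> c" if "x \<in> domain_of s" for x
      using sup[of c x] that real by simp
    have c0: "c \<ge> 0" using le[OF point[of 0]] norm_ge_zero order_trans by blast
    interpret finite_measure "mu s :: (real^'d) measure" by (rule finite_measure_mu)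
    have "(L2_norm (mu s) remainder)\<^sup>2 = (LINT x|mu s. (norm (remainder x))\<^sup>2)"
      by (simp add: L2_norm_def Bochner_Integration.integral_nonneg)
    also have "\<dots> \<le> (LINT x|(mu s :: (real^'d) measure). c\<^sup>2)"
    proof (rule Bochner_Integration.integral_mono)
      show "integrable (mu s) (\<lambda>x. (norm (remainder x))\<^sup>2)"
        by (intro integrable_mu_continuous continuous_intros continuous_remainder)
    qed (use le in \<open>auto intro: power_mono\<close>)
    also have "\<dots> = c\<^sup>2" by (simp add: measure_mu)
    finally have L2: "(L2_norm (mu s) remainder)\<^sup>2 \<le> c\<^sup>2" .
    have "(\<Sum>i<n. (norm (remainder (phi s (lattice_point n z i))))\<^sup>2) \<le> (\<Sum>i<n. c\<^sup>2)"
      by (intro sum_mono power_mono le point norm_ge_zero)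
    then have "(sampling_seminorm s n z remainder)\<^sup>2 \<le> c\<^sup>2"
      using n by (simp add: sampling_seminorm_def sum_nonneg divide_le_eq mult.commute)
    then have "?\<rho> * (sampling_seminorm s n z remainder)\<^sup>2 \<le> ?\<rho> * c\<^sup>2" using \<rho> by (rule mult_left_mono)
    then have "(L2_norm (mu s) (\<lambda>x. f x - lattice_approx s n z \<Lambda> f x))\<^sup>2 \<le> (1 + ?\<rho>) * c\<^sup>2"
      using L2_error_le L2 by (simp add: distrib_right)
    also have "\<dots> = (sqrt (1 + ?\<rho>) * c)\<^sup>2" using \<rho> by (simp add: power_mult_distrib)
    finally have "L2_norm (mu s) (\<lambda>x. f x - lattice_approx s n z \<Lambda> f x) \<le> sqrt (1 + ?\<rho>) * c"
      by (rule power2_le_imp_le) (use \<rho> c0 in simp)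
    then show ?thesis by (simp add: real)
  next
    case PInf
    have "sqrt (1 + ?\<rho>) > 0" using \<rho> by simp
    then show ?thesis by (simp add: PInf)
  next
    case MInf
    then have "norm (remainder (phi s (lattice_point n z 0))) \<le> - 1" by (intro sup point) simp
    then have False using norm_ge_zero[of "remainder (phi s (lattice_point n z 0))"] by linarith
    then show ?thesis ..
  qed
qed

end

theorem theorem27:
  fixes s :: setting and \<Lambda> :: "(int^'d) set"
  assumes "finite \<Lambda>" and "\<Lambda> \<noteq> {}" and "\<Lambda> \<subseteq> index_domain s"
  shows
    "(\<forall>f\<in>function_space s. \<forall>n::nat. \<forall>z::int^'d. n \<ge> 1 \<and> admissible s n \<Lambda> z \<longrightarrow>
       (L2_norm (mu s) (\<lambda>x. f x - lattice_approx s n z \<Lambda> f x))\<^sup>2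
         \<le> (L2_norm (mu s) (\<lambda>x. f x - truncation s \<Lambda> f x))\<^sup>2
           + rho (plan_of s) n z \<Lambda>
             * (sampling_seminorm s n z (\<lambda>x. f x - truncation s \<Lambda> f x))\<^sup>2
       \<and> ereal (L2_norm (mu s) (\<lambda>x. f x - lattice_approx s n z \<Lambda> f x))
         \<le> ereal (sqrt (1 + rho (plan_of s) n z \<Lambda>))
           * Linf_norm (mu s) (\<lambda>x. f x - truncation s \<Lambda> f x))
     \<and> (\<forall>n::nat. \<forall>z::int^'d. n \<ge> 1 \<longrightarrow>
          rho PlanA n z \<Lambda> = 1 \<and>
          (downward_closed \<Lambda> \<longrightarrow>
             rho PlanC n z \<Lambda> \<le> rho PlanB n z \<Lambda> \<and>
             rho PlanB n z \<Lambda> \<le> min (2 ^ (CARD('d) - 1)) (real (card \<Lambda>))))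
     \<and> (\<forall>n::nat. prime n \<and> real n > max (threshold s \<Lambda>) (2 * real_of_int (max_abs \<Lambda>)) \<longrightarrow>
          (\<exists>z::int^'d. admissible s n \<Lambda> z))"
proof (intro conjI ballI allI impI)
  fix f :: "real^'d \<Rightarrow> complex" and n :: nat and z :: "int^'d"
  assume f: "f \<in> function_space s" and nz: "n \<ge> 1 \<and> admissible s n \<Lambda> z"
  note hyps = assms f conjunct1[OF nz] conjunct2[OF nz]
  show "(L2_norm (mu s) (\<lambda>x. f x - lattice_approx s n z \<Lambda> f x))\<^sup>2
      \<le> (L2_norm (mu s) (\<lambda>x. f x - truncation s \<Lambda> f x))\<^sup>2
        + rho (plan_of s) n z \<Lambda>
          * (sampling_seminorm s n z (\<lambda>x. f x - truncation s \<Lambda> f x))\<^sup>2"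
    using L2_error_le[OF hyps] unfolding remainder_def[OF hyps, abs_def] .
  show "ereal (L2_norm (mu s) (\<lambda>x. f x - lattice_approx s n z \<Lambda> f x))
      \<le> ereal (sqrt (1 + rho (plan_of s) n z \<Lambda>))
        * Linf_norm (mu s) (\<lambda>x. f x - truncation s \<Lambda> f x)"
    using L2_error_le_Linf[OF hyps] unfolding remainder_def[OF hyps, abs_def] .
next
  fix n :: nat and z :: "int^'d"
  show "rho PlanA n z \<Lambda> = 1" by (rule rho_PlanA[OF assms(2)])
  show "rho PlanC n z \<Lambda> \<le> rho PlanB n z \<Lambda>" by (rule rho_PlanC_le_PlanB[OF assms(1,2)])
  show "rho PlanB n z \<Lambda> \<le> min (2 ^ (CARD('d) - 1)) (real (card \<Lambda>))" if "downward_closed \<Lambda>"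
    by (rule rho_PlanB_le_downward_closed[OF assms(1,2) that])
next
  fix n :: nat
  assume "prime n \<and> real n > max (threshold s \<Lambda>) (2 * real_of_int (max_abs \<Lambda>))"
  then show "\<exists>z::int^'d. admissible s n \<Lambda> z"
    using ex_admissible[OF assms] by simp
qed

end
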